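(* Let $D$ be an oriented diagram of a link $L$ with regions $1,\ldots,n$ and arcs $1,\ldots,r$, and let $\mathcal{I}=\{\exp(w_k\frac{\partial W}{\partial w_k})=1\mid k=1,\ldots,n\}$ be its hyperbolicity equations, where $W$ is the potential function of $D$. For any essential solution $\mathbf{w}^{(0)}=(w_1^{(0)},\ldots,w_n^{(0)})$ of $\mathcal{I}$ there exist an arc-coloring $\{a_1,\ldots,a_r\}$ of $D$, a region-coloring $\{s_1,\ldots,s_n\}$ of $D$ and an element $p\in\mathbb{C}^2\setminus\{0\}$ satisfying $$w_k^{(0)}=\det(p,s_k)\qquad\text{for } k=1,\ldots,n.$$
   Context: Diagrams are assumed to have no trivial-knot component that has only over-crossings, or only under-crossings, or no crossing. Complex variables $w_1,\ldots,w_n$ are assigned to the regions of $D$. **Potential function.** At a crossing $j$ let $w_a$ be the variable of the region in the corner between the two outgoing ends, $w_c$ that of the corner between the two incoming ends, $w_b,w_d$ those of the other two corners. With the dilogarithm $\mathrm{Li}_2(z)=-\int_0^z\frac{\log(1-t)}{t}dt$, for a positive crossing put $$W^j=-\mathrm{Li}_2(\tfrac{w_c}{w_b})-\mathrm{Li}_2(\tfrac{w_c}{w_d})+\mathrm{Li}_2(\tfrac{w_aw_c}{w_bw_d})+\mathrm{Li}_2(\tfrac{w_b}{w_a})+\mathrm{Li}_2(\tfrac{w_d}{w_a})-\tfrac{\pi^2}{6}+\log\tfrac{w_b}{w_a}\log\tfrac{w_d}{w_a},$$ and for a negative crossing let $W^j$ be the negative of this expression. Then $W=\sum_j W^j$ over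 all crossings. Each $\exp(w_k\frac{\partial W}{\partial w_k})$ is a rational function of the $w$'s; a solution of $\mathcal{I}$ is a point where these are defined and equal to $1$. A solution is essential if $w_k^{(0)}\neq0$ for all $k$ and $w_k^{(0)}\neq w_m^{(0)}$ whenever the regions $k$ and $m$ are adjacent. **Colorings.** $\mathcal{P}=(\mathbb{C}^2\setminus\{0\})/\pm$ (row vectors), identified with the parabolic elements of $\mathrm{PSL}(2,\mathbb{C})$ via $(\alpha\ \beta)\mapsto\widehat a(z)=\frac{(1+\alpha\beta)z-\alpha^2}{\beta^2z+1-\alpha\beta}$. For vectors, $$v*(\gamma\ \delta)=v\begin{pmatrix}1+\gamma\delta&\delta^2\\-\gamma^2&1-\gamma\delta\end{pmatrix},$$ which corresponds to conjugation of parabolic elements; $v*(\pm a)=v*a$. An arc-coloring assigns to each arc an element of $\mathcal{P}$ so that at each crossing with over-arc color $a$, the color of the under-arc on the left of the (oriented) over-strand equals $a_l*a$ (in $\mathcal{P}$), where $a_l$ is the color of the under-arc on the right of the over-strand; equivalently, the arc-colors are the images of the meridians of the arcs under a boundary-parabolic representation $\pi_1(\mathbb{S}^3\setminus L)\to\mathrm{PSL}(2,\mathbb{C})$. A region-coloring assigns vectors $s_1,\ldots,s_n\in\mathbb{C}^2\setminus\{0\}$ to the regions so that if $s$ is the color of the region on the right of an oriented arc colored $a$, then the region on its left has color $s*a$. $\det(x,y)$ denotes the determinant of the $2\times 2$ matrix with rows $x,y$.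
   Formalization: A solution is required to have the factor of exp(w_k ∂W/∂w_k) from each single crossing defined (so w_a w_c ≠ w_b w_d at every crossing); if factors of different crossings may first cancel, the claim fails, e.g. for two overlapping circles with local knots tied in. *)

theory Defs
  imports "HOL-Complex_Analysis.Complex_Analysis"
begin

section \<open>Oriented link diagrams\<close>

text \<open>
  A diagram is given combinatorially, by an oriented signed Gauss code together with its regions.
  Every crossing is rotated so that both strands run upwards.  North is then the corner between
  the two outgoing ends, South the corner between the two incoming ends, West and East are the
  other two.

  A pair \<open>(j, t)\<close> names the strand \<open>t\<close> passing through the crossing \<open>j\<close>; it also names the
  edge (the piece of the diagram between two consecutive crossings) that leaves \<open>j\<close> along
  that strand.  This edge arrives at the passage \<open>succ D (j, t)\<close>.
\<close>

datatype strand = Over | Under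
datatype corner = North | South | West | East

type_synonym 'c edge = "'c \<times> strand"

record ('c, 'r) diagram =
  positive :: "'c \<Rightarrow> bool"
  succ :: "'c edge \<Rightarrow> 'c edge"
  region :: "'c \<times> corner \<Rightarrow> 'r"

text \<open>
  At a positive crossing the over-strand runs from south-west to north-east and the under-strand
  from south-east to north-west; at a negative crossing it is the other way round.
\<close>

definition rising :: "('c, 'r) diagram \<Rightarrow> 'c edge \<Rightarrow> bool" where
  "rising D e \<longleftrightarrow> (positive D (fst e) \<longleftrightarrow> snd e = Over)"

text \<open>
  \<open>out_left\<close> and \<open>out_right\<close> are the corners beside the outgoing end of a passage, \<open>in_left\<close> and
  \<open>in_right\<close> those beside its incoming end.
\<close>

definition out_left :: "('c, 'r) diagram \<Rightarrow> 'c edge \<Rightarrow> 'c \<times> corner" where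
  "out_left D e = (fst e, if rising D e then North else West)"
definition out_right :: "('c, 'r) diagram \<Rightarrow> 'c edge \<Rightarrow> 'c \<times> corner" where
  "out_right D e = (fst e, if rising D e then East else North)"
definition in_left :: "('c, 'r) diagram \<Rightarrow> 'c edge \<Rightarrow> 'c \<times> corner" where
  "in_left D e = (fst e, if rising D e then West else South)"
definition in_right :: "('c, 'r) diagram \<Rightarrow> 'c edge \<Rightarrow> 'c \<times> corner" where
  "in_right D e = (fst e, if rising D e then South else East)"

definition left_region :: "('c, 'r) diagram \<Rightarrow> 'c edge \<Rightarrow> 'r" where
  "left_region D e = region D (out_left D e)"
definition right_region :: "('c, 'r) diagram \<Rightarrow> 'c edge \<Rightarrow> 'r" where
  "right_region D e = region D (out_right D e)"

text \<open>Two corners are joined if they lie at the two ends of one side of an edge.\<close>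

definition corner_joined :: "('c, 'r) diagram \<Rightarrow> 'c \<times> corner \<Rightarrow> 'c \<times> corner \<Rightarrow> bool" where
  "corner_joined D x y \<longleftrightarrow>
     (\<exists>e. (x = out_left D e \<and> y = in_left D (succ D e)) \<or>
          (x = out_right D e \<and> y = in_right D (succ D e)))"

definition crossing_joined :: "('c, 'r) diagram \<Rightarrow> 'c \<Rightarrow> 'c \<Rightarrow> bool" where
  "crossing_joined D j j' \<longleftrightarrow> (\<exists>t t'. succ D (j, t) = (j', t'))"

text \<open>
  \<open>faces D\<close> are the boundary walks of the underlying four-valent graph, \<open>components D\<close> its
  connected components.
\<close>

definition faces :: "('c, 'r) diagram \<Rightarrow> ('c \<times> corner) set set" where
  "faces D = UNIV // {(x, y). equivclp (corner_joined D) x y}"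

definition components :: "('c, 'r) diagram \<Rightarrow> 'c set set" where
  "components D = UNIV // {(j, j'). equivclp (crossing_joined D) j j'}"

text \<open>
  The underlying graph need not be connected, so a region may be bounded by several faces, of
  different components.  Planarity is the conjunction of two conditions.  First, every component
  has genus zero: Euler characteristics are at most 2, so this is \<open>V - E + F = 2 C\<close>.  Secondly,
  the components are placed on one sphere: the bipartite graph on components and regions,
  with one edge for each face, is a tree, i.e. connected with one edge less than vertices.
\<close>

definition link_diagram :: "('c::finite, 'r::finite) diagram \<Rightarrow> bool" where
  "link_diagram D \<longleftrightarrow>
     bij (succ D) \<and>
     (\<forall>x y. corner_joined D x y \<longrightarrow> region D x = region D y) \<and>
     surj (region D) \<and>
     CARD('c) + card (faces D) = CARD('c edge) + 2 * card (components D) \<and>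
     (\<forall>j j'. equivclp (\<lambda>i i'. \<exists>x x'. region D (i, x) = region D (i', x')) j j') \<and>
     card (components D) + CARD('r) = card (faces D) + 1"

text \<open>
  Every link component has an over-crossing and an under-crossing.  (A component with only
  over-crossings or only under-crossings does not cross itself and is therefore a trivial knot;
  components without crossings cannot be encoded in a \<open>diagram\<close>.)
\<close>

definition no_bare_component :: "('c, 'r) diagram \<Rightarrow> bool" where
  "no_bare_component D \<longleftrightarrow>
     (\<forall>e. (\<exists>m. snd ((succ D ^^ m) e) = Over) \<and> (\<exists>m. snd ((succ D ^^ m) e) = Under))"

text \<open>An arc is a maximal sequence of edges joined at over-crossings.\<close>

definition arc_joined :: "('c, 'r) diagram \<Rightarrow> 'c edge \<Rightarrow> 'c edge \<Rightarrow> bool" where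
  "arc_joined D e e' \<longleftrightarrow> succ D e = e' \<and> snd e' = Over"

definition arc_of :: "('c, 'r) diagram \<Rightarrow> 'c edge \<Rightarrow> 'c edge set" where
  "arc_of D e = {e'. equivclp (arc_joined D) e e'}"


section \<open>The potential function\<close>

definition Li2 :: "complex \<Rightarrow> complex" where
  "Li2 z = - contour_integral (linepath 0 z) (\<lambda>t. Ln (1 - t) / t)"

definition crossing_potential :: "complex \<Rightarrow> complex \<Rightarrow> complex \<Rightarrow> complex \<Rightarrow> complex" where
  "crossing_potential a b c d =
     - Li2 (c / b) - Li2 (c / d) + Li2 ((a * c) / (b * d)) + Li2 (b / a) + Li2 (d / a)
     - of_real (pi\<^sup>2) / 6 + Ln (b / a) * Ln (d / a)"

text \<open>The potential is symmetric in the West and East variables.\<close>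

definition potential_at :: "('c, 'r) diagram \<Rightarrow> 'c \<Rightarrow> ('r \<Rightarrow> complex) \<Rightarrow> complex" where
  "potential_at D j w =
     (if positive D j then 1 else - 1) *
     crossing_potential (w (region D (j, North))) (w (region D (j, West)))
                        (w (region D (j, South))) (w (region D (j, East)))"

definition potential :: "('c::finite, 'r) diagram \<Rightarrow> ('r \<Rightarrow> complex) \<Rightarrow> complex" where
  "potential D w = (\<Sum>j\<in>UNIV. potential_at D j w)"

text \<open>
  Where all arguments of \<open>Li2\<close> and \<open>Ln\<close> are non-real, the principal branches are holomorphic.
  This is an open set, nonempty as soon as regions on the two sides of an edge are different.
\<close>

definition principal_domain_at :: "('c, 'r) diagram \<Rightarrow> 'c \<Rightarrow> ('r \<Rightarrow> complex) set" where
  "principal_domain_at D j =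
     {w. let a = w (region D (j, North)); b = w (region D (j, West));
             c = w (region D (j, South)); d = w (region D (j, East))
         in {c / b, c / d, (a * c) / (b * d), b / a, d / a} \<inter> \<real> = {}}"

definition principal_domain :: "('c, 'r) diagram \<Rightarrow> ('r \<Rightarrow> complex) set" where
  "principal_domain D = (\<Inter>j. principal_domain_at D j)"

definition partial_deriv :: "(('r \<Rightarrow> complex) \<Rightarrow> complex) \<Rightarrow> 'r \<Rightarrow> ('r \<Rightarrow> complex) \<Rightarrow> complex" where
  "partial_deriv F k w = deriv (\<lambda>z. F (w(k := z))) (w k)"

definition exp_log_deriv :: "(('r \<Rightarrow> complex) \<Rightarrow> complex) \<Rightarrow> 'r \<Rightarrow> ('r \<Rightarrow> complex) \<Rightarrow> complex" where
  "exp_log_deriv F k w = exp (w k * partial_deriv F k w)"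

inductive polynomial_map :: "(('r \<Rightarrow> complex) \<Rightarrow> complex) \<Rightarrow> bool" where
  const: "polynomial_map (\<lambda>w. c)"
| var: "polynomial_map (\<lambda>w. w k)"
| add: "polynomial_map P \<Longrightarrow> polynomial_map Q \<Longrightarrow> polynomial_map (\<lambda>w. P w + Q w)"
| mult: "polynomial_map P \<Longrightarrow> polynomial_map Q \<Longrightarrow> polynomial_map (\<lambda>w. P w * Q w)"

text \<open>
  The rational function which agrees with \<open>f\<close> on the set \<open>G\<close> is defined at \<open>w\<close> and takes the
  value \<open>x\<close> there.  (For nonempty open \<open>G\<close> there is at most one such rational function.)
\<close>

definition rational_value ::
  "('r \<Rightarrow> complex) set \<Rightarrow> (('r \<Rightarrow> complex) \<Rightarrow> complex) \<Rightarrow> ('r \<Rightarrow> complex) \<Rightarrow> complex \<Rightarrow> bool" where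
  "rational_value G f w x \<longleftrightarrow>
     (\<exists>P Q. polynomial_map P \<and> polynomial_map Q \<and> Q w \<noteq> 0 \<and>
            (\<forall>v\<in>G. f v * Q v = P v) \<and> x = P w / Q w)"

text \<open>
  The exponentials are products over the crossings, and are regarded as defined only where the
  factors of all crossings are: a factor that becomes zero or infinite on the locus
  \<open>w\<^sub>a w\<^sub>c = w\<^sub>b w\<^sub>d\<close>, where the potential itself has a branch point, may not be cancelled against
  the factor of another crossing.
\<close>

definition hyperbolicity_defined :: "('c, 'r) diagram \<Rightarrow> ('r \<Rightarrow> complex) \<Rightarrow> bool" where
  "hyperbolicity_defined D w \<longleftrightarrow>
     (\<forall>j k. \<exists>x. rational_value (principal_domain_at D j) (exp_log_deriv (potential_at D j) k) w x)"

definition hyperbolicity_solution :: "('c::finite, 'r) diagram \<Rightarrow> ('r \<Rightarrow> complex) \<Rightarrow> bool" where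
  "hyperbolicity_solution D w \<longleftrightarrow>
     hyperbolicity_defined D w \<and>
     (\<forall>k. rational_value (principal_domain D) (exp_log_deriv (potential D) k) w 1)"

definition essential :: "('c, 'r) diagram \<Rightarrow> ('r \<Rightarrow> complex) \<Rightarrow> bool" where
  "essential D w \<longleftrightarrow>
     (\<forall>k. w k \<noteq> 0) \<and> (\<forall>e. w (left_region D e) \<noteq> w (right_region D e))"


section \<open>Arc-colorings and region-colorings\<close>

type_synonym vec2 = "complex ^ 2"

definition det2 :: "vec2 \<Rightarrow> vec2 \<Rightarrow> complex" where
  "det2 x y = det (vector [x, y] :: complex ^ 2 ^ 2)"

definition vstar :: "vec2 \<Rightarrow> vec2 \<Rightarrow> vec2" where
  "vstar v a = v v* (vector [vector [1 + a $ 1 * a $ 2, (a $ 2)\<^sup>2],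
                             vector [- ((a $ 1)\<^sup>2), 1 - a $ 1 * a $ 2]] :: complex ^ 2 ^ 2)"

text \<open>The elements of \<open>(\<complex>\<^sup>2 - {0}) / \<plusminus>\<close> are the two-element sets \<open>{v, -v}\<close>.\<close>

definition parabolics :: "vec2 set set" where
  "parabolics = {{v, - v} | v. v \<noteq> 0}"

definition pstar :: "vec2 set \<Rightarrow> vec2 set \<Rightarrow> vec2 set" where
  "pstar A B = {vstar x y | x y. x \<in> A \<and> y \<in> B}"

text \<open>
  The under-strand passes from the right to the left of the over-strand at a positive crossing,
  and from the left to the right at a negative one.
\<close>

definition arc_coloring :: "('c, 'r) diagram \<Rightarrow> ('c edge set \<Rightarrow> vec2 set) \<Rightarrow> bool" where
  "arc_coloring D a \<longleftrightarrow>
     (\<forall>e. a (arc_of D e) \<in> parabolics) \<and>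
     (\<forall>j e. succ D e = (j, Under) \<longrightarrow>
        (let over = a (arc_of D (j, Over));
             under_in = a (arc_of D e);
             under_out = a (arc_of D (j, Under))
         in if positive D j then under_out = pstar under_in over
            else under_in = pstar under_out over))"

definition region_coloring ::
  "('c, 'r) diagram \<Rightarrow> ('c edge set \<Rightarrow> vec2 set) \<Rightarrow> ('r \<Rightarrow> vec2) \<Rightarrow> bool" where
  "region_coloring D a s \<longleftrightarrow>
     (\<forall>k. s k \<noteq> 0) \<and>
     (\<forall>e. \<forall>v \<in> a (arc_of D e). s (left_region D e) = vstar (s (right_region D e)) v)"

end

theory Submission
  imports Defs
begin

text \<open>
  Normalise \<open>p = (1, 0)\<close> and write the region colors as \<open>s\<^sub>k = (x\<^sub>k w\<^sub>k, w\<^sub>k)\<close>.  For an arc color with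
  fixed point \<open>z\<close>, the quantity \<open>\<mu> = w\<^sub>k (x\<^sub>k - z)\<close> is the same for the two regions beside an edge.
  Around a crossing, the quotients of consecutive \<open>\<mu>\<close>s are exactly the factors that the crossing
  contributes to the hyperbolicity equations.  Hence these equations say that the quotients form a
  closed multiplicative 1-cochain, whose 2-cells are the crossings and the regions, and \<open>\<mu>\<close> exists
  because the first cohomology of the sphere vanishes.  Then \<open>\<mu> (1 / w\<^sub>l - 1 / w\<^sub>r)\<close> is a
  closed additive cochain on the dual graph, and \<open>x\<close> is its integral.
\<close>

subsection \<open>Closed cochains on the sphere\<close>

text \<open>A parabolic acts as a transvection \<open>v \<mapsto> v + det(v, a) a\<close>, which
  preserves the determinant with its own vector. This is why \<open>\<mu> = det(s, (z, 1))\<close>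
  agrees on the two sides of an edge; subtracting \<open>x = z + \<mu> / w\<close> for the two sides
  gives the cochain that \<open>x\<close> integrates. Two obstacles shape the proof. The equations
  only prescribe values of rational functions with unknown representations, at a point where the
  principal branches may fail. They are carried there from generic points as cross-multiplied
  polynomial identities, and vanishing denominators have to be excluded separately. Moreover a
  diagram may be disconnected, so regions need not be discs. Exactness therefore rests on counting
  cells against spanning forests; it holds over any abelian group and is used with multiplicative
  and then with additive complex coefficients. The arc relation at a crossing is forced by the
  region colors: both ways across the crossing end in the same color, and region colors determine
  arc colors up to sign.\<close>

lemma spanning_forest:
  fixes src tgt :: "'e::finite \<Rightarrow> 'v::finite" and R :: "'v set"
  assumes cut: "\<forall>U. R \<subseteq> U \<and> (\<forall>e\<in>S. src e \<in> U \<longleftrightarrow> tgt e \<in> U) \<longrightarrow> U = UNIV"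
  shows "\<exists>T \<subseteq> S. card T + card R = CARD('v) \<and>
    (\<forall>f :: 'e \<Rightarrow> 'a::ab_group_add. \<exists>g. \<forall>e\<in>T. f e = g (tgt e) - g (src e)) \<and>
    (\<forall>f :: 'e \<Rightarrow> 'a. (\<forall>e. e \<notin> T \<longrightarrow> f e = 0) \<longrightarrow>
       (\<forall>v. (\<Sum>e | tgt e = v. f e) = (\<Sum>e | src e = v. f e)) \<longrightarrow> f = (\<lambda>_. 0))"
proof -
  \<comment> \<open>Forests grown from the roots \<open>R\<close>, with \<open>U\<close> the set of
    vertices reached so far. Each new edge reaches exactly one new vertex, which preserves the count
    and both statements about cochains.\<close>
  define tree where "tree U T \<longleftrightarrow> R \<subseteq> U \<and> T \<subseteq> S \<and> card T + card R = card U \<and>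
    (\<forall>e\<in>T. src e \<in> U \<and> tgt e \<in> U) \<and>
    (\<forall>f :: 'e \<Rightarrow> 'a. \<exists>g. \<forall>e\<in>T. f e = g (tgt e) - g (src e)) \<and>
    (\<forall>f :: 'e \<Rightarrow> 'a. (\<forall>e. e \<notin> T \<longrightarrow> f e = 0) \<longrightarrow>
       (\<forall>v. (\<Sum>e | tgt e = v. f e) = (\<Sum>e | src e = v. f e)) \<longrightarrow> f = (\<lambda>_. 0))" for U T
  have "tree U T \<Longrightarrow> \<exists>T. tree UNIV T" for U T
  proof (induction "card (- U)" arbitrary: U T rule: less_induct)
    case less
    show ?case
    proof (cases "U = UNIV")
      case True
      then show ?thesis using less.prems by blast
    next
      case False
      from less.prems have RU: "R \<subseteq> U" and TS: "T \<subseteq> S" and cTU: "card T + card R = card U"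
        and ends: "\<And>e. e \<in> T \<Longrightarrow> src e \<in> U \<and> tgt e \<in> U"
        and integ: "\<And>f :: 'e \<Rightarrow> 'a. \<exists>g. \<forall>e\<in>T. f e = g (tgt e) - g (src e)"
        and acyc: "\<And>f :: 'e \<Rightarrow> 'a. (\<forall>e. e \<notin> T \<longrightarrow> f e = 0) \<Longrightarrow>
          (\<forall>v. (\<Sum>e | tgt e = v. f e) = (\<Sum>e | src e = v. f e)) \<Longrightarrow> f = (\<lambda>_. 0)"
        unfolding tree_def by auto
      obtain e0 where e0: "e0 \<in> S" "src e0 \<in> U \<longleftrightarrow> tgt e0 \<notin> U"
        using cut RU False by blast
      define x where "x = (if src e0 \<in> U then tgt e0 else src e0)"
      have xU: "x \<notin> U" using e0 by (auto simp: x_def)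
      have e0T: "e0 \<notin> T" using e0 ends by blast
      have "tree (insert x U) (insert e0 T)"
        unfolding tree_def
      proof (intro conjI allI impI ballI)
        show "card (insert e0 T) + card R = card (insert x U)"
          using e0T xU cTU by simp
      next
        fix f :: "'e \<Rightarrow> 'a"
        obtain g where g: "\<forall>e\<in>T. f e = g (tgt e) - g (src e)" using integ by blast
        \<comment> \<open>The value at the new vertex is forced by \<open>e0\<close>, read along or
          against its orientation.\<close>
        define g' where "g' = g(x := if src e0 \<in> U then g (src e0) + f e0 else g (tgt e0) - f e0)"
        have "f e = g' (tgt e) - g' (src e)" if "e \<in> insert e0 T" for e
        proof (cases "e = e0")
          case True
          show ?thesis
            using e0(2) unfolding True g'_def x_def by (auto simp: algebra_simps)
        next
          case False
          with that have "e \<in> T" by simp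
          then have "tgt e \<noteq> x" "src e \<noteq> x" using ends xU by auto
          then show ?thesis using g \<open>e \<in> T\<close> by (simp add: g'_def)
        qed
        then show "\<exists>g. \<forall>e\<in>insert e0 T. f e = g (tgt e) - g (src e)" by blast
      next
        fix f :: "'e \<Rightarrow> 'a"
        assume supp: "\<forall>e. e \<notin> insert e0 T \<longrightarrow> f e = 0"
          and div: "\<forall>v. (\<Sum>e | tgt e = v. f e) = (\<Sum>e | src e = v. f e)"
        \<comment> \<open>The new vertex is a leaf: only \<open>e0\<close> can carry a nonzero value
          there, so balance at \<open>x\<close> forces \<open>f e0 = 0\<close>.\<close>
        have supp': "f e = 0" if "e \<noteq> e0" "tgt e = x \<or> src e = x" for e
          using supp that ends xU by blast
        have only: "(\<Sum>e | h e = x. f e) = (if h e0 = x then f e0 else 0)"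
          if "h = src \<or> h = tgt" for h
        proof -
          have "(\<Sum>e | h e = x. f e) = (\<Sum>e | e \<in> {e. h e = x}. if e = e0 then f e0 else 0)"
            using supp' that by (intro sum.cong) auto
          then show ?thesis by (simp add: sum.delta)
        qed
        have "f e0 = 0"
          using div[rule_format, of x] only[of src] only[of tgt] e0(2) xU
          by (auto simp: x_def split: if_splits)
        then show "f = (\<lambda>_. 0)" using supp div by (intro acyc) auto
      qed (use RU TS e0 ends in \<open>auto simp: x_def\<close>)
      moreover have "card (- insert x U) < card (- U)"
        using xU by (intro psubset_card_mono) auto
      ultimately show ?thesis using less.hyps by blast
    qed
  qed
  moreover have "tree R {}" by (auto simp: tree_def)
  ultimately obtain T where "tree UNIV T" by blast
  then show ?thesis unfolding tree_def by (elim conjE, intro exI[of _ T] conjI)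
qed

text \<open>
  Tree-cotree argument: remove a spanning forest of the dual graph (on the 2-cells).  By the count,
  the remaining edges form a spanning forest of the primal graph, on which every cochain integrates,
  and a closed cochain supported on the removed forest vanishes.
\<close>

lemma closed_imp_exact:
  fixes src tgt :: "'e::finite \<Rightarrow> 'v::finite" and lft rgt :: "'e \<Rightarrow> 'f::finite"
    and f :: "'e \<Rightarrow> 'a::ab_group_add"
  assumes coboundary_closed: "\<And>(g :: 'v \<Rightarrow> 'a) x.
      (\<Sum>e | lft e = x. g (tgt e) - g (src e)) = (\<Sum>e | rgt e = x. g (tgt e) - g (src e))"
    and cut: "\<And>U. R \<subseteq> U \<Longrightarrow> (\<And>e. src e \<in> U \<longleftrightarrow> tgt e \<in> U) \<Longrightarrow> U = UNIV"
    and cut': "\<And>U. R' \<subseteq> U \<Longrightarrow> (\<And>e. rgt e \<in> U \<longleftrightarrow> lft e \<in> U) \<Longrightarrow> U = UNIV"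
    and count: "CARD('e) + card R + card R' \<le> CARD('v) + CARD('f)"
    and closed: "\<And>x. (\<Sum>e | lft e = x. f e) = (\<Sum>e | rgt e = x. f e)"
  shows "\<exists>g. \<forall>e. f e = g (tgt e) - g (src e)"
proof (cases "\<exists>a::'a. a \<noteq> 0")
  case False
  then have "x = y" for x y :: 'a by metis
  then show ?thesis by blast
next
  case True
  then obtain a :: 'a where a: "a \<noteq> 0" by blast
  have "\<forall>U. R' \<subseteq> U \<and> (\<forall>e\<in>UNIV. rgt e \<in> U \<longleftrightarrow> lft e \<in> U) \<longrightarrow> U = UNIV"
    using cut' by simp
  from spanning_forest[of R' UNIV rgt lft, where ?'a = 'a, OF this]
  obtain T where T: "card T + card R' = CARD('f)"
    "\<forall>f :: 'e \<Rightarrow> 'a. (\<forall>e. e \<notin> T \<longrightarrow> f e = 0) \<longrightarrow>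
       (\<forall>v. (\<Sum>e | lft e = v. f e) = (\<Sum>e | rgt e = v. f e)) \<longrightarrow> f = (\<lambda>_. 0)"
    by (elim exE conjE) (rule that)
  have tree_zero: "f = (\<lambda>_. 0)" if "\<And>e. e \<notin> T \<Longrightarrow> f e = 0"
    "\<And>v. (\<Sum>e | lft e = v. f e) = (\<Sum>e | rgt e = v. f e)" for f :: "'e \<Rightarrow> 'a"
    using T(2) that by simp
  have "\<forall>U. R \<subseteq> U \<and> (\<forall>e\<in>-T. src e \<in> U \<longleftrightarrow> tgt e \<in> U) \<longrightarrow> U = UNIV"
  proof (intro allI impI, elim conjE)
    fix U assume RU: "R \<subseteq> U" and U: "\<forall>e\<in>-T. src e \<in> U \<longleftrightarrow> tgt e \<in> U"
    \<comment> \<open>The coboundary of this indicator is closed and vanishes off \<open>T\<close>,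
      hence everywhere. So a cut that no edge outside \<open>T\<close> crosses is crossed by no edge
      at all.\<close>
    define g where "g v = (if v \<in> U then a else 0)" for v
    have "(\<lambda>e. g (tgt e) - g (src e)) = (\<lambda>_. 0)"
      by (rule tree_zero) (use U coboundary_closed in \<open>auto simp: g_def\<close>)
    then have "g (tgt e) = g (src e)" for e by (metis eq_iff_diff_eq_0)
    then have "src e \<in> U \<longleftrightarrow> tgt e \<in> U" for e using a by (metis g_def)
    then show "U = UNIV" using cut RU by blast
  qed
  from spanning_forest[of R "- T" src tgt, where ?'a = 'a, OF this]
  obtain T' where T': "T' \<subseteq> - T" "card T' + card R = CARD('v)"
    "\<forall>f :: 'e \<Rightarrow> 'a. \<exists>g. \<forall>e\<in>T'. f e = g (tgt e) - g (src e)"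
    by (elim exE conjE) (rule that)
  \<comment> \<open>The Euler count leaves no edge outside both \<open>T\<close> and
    \<open>T'\<close>.\<close>
  have "card (- T) + card T = CARD('e)"
    using card_Un_disjoint[of "- T" T] by (simp add: Un_commute Compl_partition)
  then have "card (- T) \<le> card T'" using T(1) T'(2) count by linarith
  then have "T' = - T" using T'(1) by (intro card_seteq) auto
  with T'(3)[rule_format, of f] obtain g where g: "\<And>e. e \<notin> T \<Longrightarrow> f e = g (tgt e) - g (src e)" by auto
  have "(\<lambda>e. f e - (g (tgt e) - g (src e))) = (\<lambda>_. 0)"
    by (rule tree_zero) (use g closed coboundary_closed[of g] in \<open>simp_all only: sum_subtractf, simp_all\<close>)
  then show ?thesis by (metis eq_iff_diff_eq_0)
qed

subsection \<open>Derivatives of the potential\<close>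

lemma UNIV_corner: "(UNIV :: corner set) = {North, South, West, East}"
  using corner.exhaust by auto

instance corner :: finite
  by standard (simp add: UNIV_corner)

text \<open>The integrand has a removable singularity at 0 and is holomorphic off the ray from 1 to
  infinity. The complement of that ray is starlike about 0, so a primitive exists there and straight
  segments compute it.\<close>

lemma Li2_has_field_derivative:
  assumes "z \<notin> \<real>"
  shows "(Li2 has_field_derivative - Ln (1 - z) / z) (at z)"
proof -
  define S where "S = - (complex_of_real ` {1..})"
  \<comment> \<open>The value -1 at 0 is the limit; the quotient itself would evaluate to 0
    there.\<close>
  define h where "h t = (if t = 0 then - 1 else Ln (1 - t) / t)" for t :: complex
  have S_iff: "t \<in> S \<longleftrightarrow> 1 - t \<notin> \<real>\<^sub>\<le>\<^sub>0" for t
    by (auto simp: S_def complex_nonpos_Reals_iff complex_eq_iff image_iff)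
  have "closed (complex_of_real ` {1..})"
    by (intro closed_injective_linear_image) (auto simp: bounded_linear.linear bounded_linear_of_real inj_def)
  then have S: "open S" unfolding S_def by (rule open_Compl)
  have 0: "0 \<in> S" by (auto simp: S_def)
  have seg: "closed_segment 0 t \<subseteq> S" if "t \<in> S" for t
  proof
    fix x assume "x \<in> closed_segment 0 t"
    then obtain u where u: "0 \<le> u" "u \<le> 1" "x = u *\<^sub>R t" by (auto simp: in_segment)
    have "u * Re t \<le> max (Re t) 0"
      using u(1,2) by (cases "Re t \<ge> 0") (auto simp: mult_left_le_one_le mult_nonneg_nonpos)
    then show "x \<in> S" using that u by (auto simp: S_iff complex_nonpos_Reals_iff)
  qed
  have "starlike S" using 0 seg by (auto simp: starlike_def)
  have hol: "(\<lambda>t. Ln (1 - t)) holomorphic_on S"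
    by (intro holomorphic_intros) (auto simp: S_iff)
  have "((\<lambda>t. Ln (1 - t)) has_field_derivative - 1) (at 0)"
    by (auto intro!: derivative_eq_intros)
  then have "deriv (\<lambda>t. Ln (1 - t)) 0 = - 1" by (rule DERIV_imp_deriv)
  then have "h holomorphic_on S"
    by (intro pole_theorem_open_0[OF hol S, of 0]) (auto simp: h_def)
  then have "\<exists>F. \<forall>x\<in>S. (F has_field_derivative h x) (at x)"
    using S \<open>starlike S\<close>
    by (intro holomorphic_starlike_primitive[where k = "{}"])
       (auto intro: holomorphic_on_imp_continuous_on holomorphic_on_imp_differentiable_at)
  then obtain F where F: "\<And>x. x \<in> S \<Longrightarrow> (F has_field_derivative h x) (at x)" by blast
  have Li2: "Li2 t = F 0 - F t" if "t \<in> S" "t \<noteq> 0" for t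
  proof -
    have "(h has_contour_integral F t - F 0) (linepath 0 t)"
      using contour_integral_primitive[of S F h "linepath 0 t"] F seg[OF that(1)]
      by (simp add: has_field_derivative_at_within)
    moreover have "contour_integral (linepath 0 t) (\<lambda>t. Ln (1 - t) / t) = contour_integral (linepath 0 t) h"
      using that(2) by (intro contour_integral_spike_finite_simple_path[of "{0}"]) (auto simp: h_def)
    ultimately show ?thesis by (simp add: Li2_def contour_integral_unique)
  qed
  have z: "z \<in> S" "z \<noteq> 0" using assms by (auto simp: S_def)
  have "((\<lambda>t. F 0 - F t) has_field_derivative - Ln (1 - z) / z) (at z)"
    using F[OF z(1)] z(2) by (auto intro!: derivative_eq_intros simp: h_def)
  then show ?thesis
    by (rule has_field_derivative_transform_within_open[of _ _ _ "S - {0}"])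
       (use S z Li2 in auto)
qed

text \<open>Derivatives are written \<open>f x * r\<close> because the logarithmic derivatives \<open>r\<close> simply add up.\<close>

lemma Li2_log_derivative:
  assumes "(f has_field_derivative f x * r) (at x)" "f x \<notin> \<real>"
  shows "((\<lambda>t. Li2 (f t)) has_field_derivative - Ln (1 - f x) * r) (at x)"
proof -
  have "f x \<noteq> 0" using assms(2) by auto
  then show ?thesis
    using DERIV_chain2[OF Li2_has_field_derivative[OF assms(2)] assms(1)] by simp
qed

lemma Ln_log_derivative:
  assumes "(f has_field_derivative f x * r) (at x)" "f x \<notin> \<real>"
  shows "((\<lambda>t. Ln (f t)) has_field_derivative r) (at x)"
proof -
  have "f x \<notin> \<real>\<^sub>\<le>\<^sub>0" "f x \<noteq> 0" using assms(2) by (auto simp: nonpos_Reals_def)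
  then show ?thesis
    using DERIV_chain2[OF has_field_derivative_Ln assms(1)] by (simp flip: mult.assoc)
qed

lemma divide_log_derivative:
  fixes f g :: "complex \<Rightarrow> complex"
  assumes "(f has_field_derivative f x * r) (at x)" "(g has_field_derivative g x * s) (at x)" "g x \<noteq> 0"
  shows "((\<lambda>t. f t / g t) has_field_derivative f x / g x * (r - s)) (at x)"
proof -
  have "(f x * r * g x - f x * (g x * s)) / (g x * g x) = f x / g x * (r - s)"
    using assms(3) by (simp add: field_simps)
  then show ?thesis using DERIV_divide[OF assms] by simp
qed

lemma mult_log_derivative:
  fixes f g :: "complex \<Rightarrow> complex"
  assumes "(f has_field_derivative f x * r) (at x)" "(g has_field_derivative g x * s) (at x)"
  shows "((\<lambda>t. f t * g t) has_field_derivative f x * g x * (r + s)) (at x)"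
  using DERIV_mult[OF assms(1,2)] by (simp add: field_simps)

text \<open>The derivative \<open>w dW/dw\<close> at a positive crossing for the variable of the
  given corner, the four corner variables being regarded as independent.\<close>

fun log_factor :: "corner \<Rightarrow> complex \<Rightarrow> complex \<Rightarrow> complex \<Rightarrow> complex \<Rightarrow> complex" where
  "log_factor North a b c d =
     - Ln (1 - a * c / (b * d)) + Ln (1 - b / a) + Ln (1 - d / a) - Ln (d / a) - Ln (b / a)"
| "log_factor West a b c d =
     - Ln (1 - c / b) + Ln (1 - a * c / (b * d)) - Ln (1 - b / a) + Ln (d / a)"
| "log_factor South a b c d = Ln (1 - c / b) + Ln (1 - c / d) - Ln (1 - a * c / (b * d))"
| "log_factor East a b c d =
     - Ln (1 - c / d) + Ln (1 - a * c / (b * d)) - Ln (1 - d / a) + Ln (b / a)"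

text \<open>All four variables are functions of one parameter because a region may occupy several
  corners of a crossing.\<close>

lemma crossing_potential_has_field_derivative:
  fixes a b c d :: "complex \<Rightarrow> complex"
  assumes a: "(a has_field_derivative a x * ra) (at x)" and b: "(b has_field_derivative b x * rb) (at x)"
    and c: "(c has_field_derivative c x * rc) (at x)" and d: "(d has_field_derivative d x * rd) (at x)"
    and dom: "{c x / b x, c x / d x, (a x * c x) / (b x * d x), b x / a x, d x / a x} \<inter> \<real> = {}"
  shows "((\<lambda>t. crossing_potential (a t) (b t) (c t) (d t)) has_field_derivative
    ra * log_factor North (a x) (b x) (c x) (d x) + rb * log_factor West (a x) (b x) (c x) (d x) +
    rc * log_factor South (a x) (b x) (c x) (d x) + rd * log_factor East (a x) (b x) (c x) (d x)) (at x)"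
proof -
  have nz: "a x \<noteq> 0" "b x \<noteq> 0" "c x \<noteq> 0" "d x \<noteq> 0" using dom by auto
  note quot = divide_log_derivative[OF c b nz(2)] divide_log_derivative[OF c d nz(4)]
    divide_log_derivative[OF mult_log_derivative[OF a c] mult_log_derivative[OF b d]]
    divide_log_derivative[OF b a nz(1)] divide_log_derivative[OF d a nz(1)]
  show ?thesis
    unfolding crossing_potential_def
    by (rule derivative_eq_intros quot[THEN Li2_log_derivative] quot[THEN Ln_log_derivative] refl
        | use dom nz in \<open>simp; fail\<close>)+
      (simp add: algebra_simps)
qed

text \<open>Numerator and denominator of the exponential of \<open>log_factor\<close>.\<close>

fun corner_factor :: "corner \<Rightarrow> complex \<Rightarrow> complex \<Rightarrow> complex \<Rightarrow> complex \<Rightarrow> complex \<times> complex" where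
  "corner_factor North a b c d = ((a - b) * (a - d), b * d - a * c)"
| "corner_factor West a b c d = (b * d - a * c, (b - c) * (a - b))"
| "corner_factor South a b c d = ((b - c) * (d - c), b * d - a * c)"
| "corner_factor East a b c d = (b * d - a * c, (d - c) * (a - d))"

lemma exp_log_factor:
  assumes "{c / b, c / d, (a * c) / (b * d), b / a, d / a} \<inter> \<real> = {}"
  shows "exp (log_factor x a b c d) = fst (corner_factor x a b c d) / snd (corner_factor x a b c d)"
    "fst (corner_factor x a b c d) \<noteq> 0" "snd (corner_factor x a b c d) \<noteq> 0"
proof -
  have nz: "a \<noteq> 0" "b \<noteq> 0" "c \<noteq> 0" "d \<noteq> 0" using assms by auto
  have "c / b \<noteq> 1" "c / d \<noteq> 1" "(a * c) / (b * d) \<noteq> 1" "b / a \<noteq> 1" "d / a \<noteq> 1"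
    using assms by auto
  then have neq: "c \<noteq> b" "c \<noteq> d" "a * c \<noteq> b * d" "b \<noteq> a" "d \<noteq> a"
    using nz by auto
  then show "fst (corner_factor x a b c d) \<noteq> 0" "snd (corner_factor x a b c d) \<noteq> 0"
    by (cases x; simp; metis)+
  have eqs: "1 - c / b = (b - c) / b" "1 - c / d = (d - c) / d"
    "1 - a * c / (b * d) = (b * d - a * c) / (b * d)" "1 - b / a = (a - b) / a" "1 - d / a = (a - d) / a"
    using nz by (simp_all add: field_simps)
  show "exp (log_factor x a b c d) = fst (corner_factor x a b c d) / snd (corner_factor x a b c d)"
    using nz neq
    by (cases x) (simp_all add: exp_add exp_diff exp_minus eqs divide_simps)
qed

subsection \<open>The hyperbolicity equations\<close>

abbreviation at_corners :: "('c, 'r) diagram \<Rightarrow> ('r \<Rightarrow> 'a) \<Rightarrow> 'c \<Rightarrow> ('a \<Rightarrow> 'a \<Rightarrow> 'a \<Rightarrow> 'a \<Rightarrow> 'b) \<Rightarrow> 'b" where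
  "at_corners D w j f \<equiv> f (w (region D (j, North))) (w (region D (j, West)))
     (w (region D (j, South))) (w (region D (j, East)))"

text \<open>A pair, because both entries are polynomials in \<open>w\<close> and remain meaningful
  where the denominator vanishes. The sign of the potential at a negative crossing inverts the
  quotient.\<close>

fun ratio_at :: "('c, 'r) diagram \<Rightarrow> ('r \<Rightarrow> complex) \<Rightarrow> 'c \<times> corner \<Rightarrow> complex \<times> complex" where
  "ratio_at D w (j, x) =
     (if positive D j then id else prod.swap) (at_corners D w j (corner_factor x))"

definition factor_at :: "('c, 'r) diagram \<Rightarrow> ('r \<Rightarrow> complex) \<Rightarrow> 'c \<times> corner \<Rightarrow> complex" where
  "factor_at D w q = fst (ratio_at D w q) / snd (ratio_at D w q)"

lemma potential_at_has_field_derivative: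
  fixes v :: "'r \<Rightarrow> complex"
  assumes dom: "v \<in> principal_domain_at D j"
  obtains l where "((\<lambda>z. potential_at D j (v(k := z))) has_field_derivative l) (at (v k))"
    "exp (v k * l) = (\<Prod>x | region D (j, x) = k. factor_at D v (j, x))"
proof -
  define s where "s = (if positive D j then 1 else - 1 :: complex)"
  define L where "L x = at_corners D v j (log_factor x)" for x
  \<comment> \<open>Logarithmic derivatives of the corner variables with respect to the variable of
    \<open>k\<close>; the factor \<open>v k\<close> later turns them into an indicator.\<close>
  define r where "r x = (if region D (j, x) = k then 1 / v k else 0)" for x
  note dom' = dom[unfolded principal_domain_at_def mem_Collect_eq Let_def]
  have nz: "v (region D (j, x)) \<noteq> 0" for x
    using dom' by (cases x) auto
  have 1: "((\<lambda>z. (v(k := z)) (region D (j, x))) has_field_derivative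
      (v(k := v k)) (region D (j, x)) * r x) (at (v k))" for x
    using nz[of x] by (auto simp: r_def)
  have 2: "((\<lambda>z. potential_at D j (v(k := z))) has_field_derivative
      s * (r North * L North + r West * L West + r South * L South + r East * L East)) (at (v k))"
    unfolding potential_at_def s_def[symmetric] L_def
    using crossing_potential_has_field_derivative[OF 1[of North] 1[of West] 1[of South] 1[of East]] dom'
    by (intro DERIV_cmult) simp
  have "v k * (s * (r North * L North + r West * L West + r South * L South + r East * L East))
      = v k * (s * (\<Sum>x\<in>UNIV. r x * L x))"
    by (simp add: UNIV_corner algebra_simps)
  also have "\<dots> = (\<Sum>x\<in>UNIV. if region D (j, x) = k then s * L x else 0)"
    using nz by (auto simp: r_def sum_distrib_left intro!: sum.cong)
  also have "\<dots> = (\<Sum>x | region D (j, x) = k. s * L x)"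
    by (simp add: sum.If_cases)
  also have "exp \<dots> = (\<Prod>x | region D (j, x) = k. exp (s * L x))"
    by (simp add: exp_sum)
  also have "\<dots> = (\<Prod>x | region D (j, x) = k. factor_at D v (j, x))"
    by (intro prod.cong refl)
      (auto simp: s_def L_def factor_at_def exp_minus exp_log_factor(1)[OF dom'])
  finally show ?thesis using that 2 by metis
qed

lemma exp_log_deriv_potential_at:
  assumes "v \<in> principal_domain_at D j"
  shows "exp_log_deriv (potential_at D j) k v = (\<Prod>x | region D (j, x) = k. factor_at D v (j, x))"
  using potential_at_has_field_derivative[OF assms]
  unfolding exp_log_deriv_def partial_deriv_def by (metis DERIV_imp_deriv)

lemma exp_log_deriv_potential:
  fixes D :: "('c::finite, 'r) diagram"
  assumes "v \<in> principal_domain D"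
  shows "exp_log_deriv (potential D) k v = (\<Prod>q | region D q = k. factor_at D v q)"
proof -
  have "\<forall>j. \<exists>l. ((\<lambda>z. potential_at D j (v(k := z))) has_field_derivative l) (at (v k)) \<and>
    exp (v k * l) = (\<Prod>x | region D (j, x) = k. factor_at D v (j, x))"
    using potential_at_has_field_derivative assms unfolding principal_domain_def by (metis INT_D UNIV_I)
  then obtain l where l: "\<And>j. ((\<lambda>z. potential_at D j (v(k := z))) has_field_derivative l j) (at (v k))"
    "\<And>j. exp (v k * l j) = (\<Prod>x | region D (j, x) = k. factor_at D v (j, x))"
    by metis
  have "((\<lambda>z. potential D (v(k := z))) has_field_derivative sum l UNIV) (at (v k))"
    unfolding potential_def by (intro DERIV_sum l)
  then have "exp_log_deriv (potential D) k v = (\<Prod>j\<in>UNIV. exp (v k * l j))"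
    by (simp add: exp_log_deriv_def partial_deriv_def DERIV_imp_deriv sum_distrib_left exp_sum)
  also have "\<dots> = (\<Prod>q\<in>(SIGMA j:UNIV. {x. region D (j, x) = k}). factor_at D v q)"
    by (simp add: l prod.Sigma)
  also have "(SIGMA j:UNIV. {x. region D (j, x) = k}) = {q. region D q = k}" by auto
  finally show ?thesis .
qed

lemma ratio_at_nonzero:
  assumes "v \<in> principal_domain_at D (fst q)"
  shows "fst (ratio_at D v q) \<noteq> 0" "snd (ratio_at D v q) \<noteq> 0"
  using assms exp_log_factor(2,3) unfolding principal_domain_at_def Let_def mem_Collect_eq
  by (cases q; simp)+

section \<open>Polynomial identities that hold on the principal domain\<close>

lemma polynomial_map_diff:
  "polynomial_map P \<Longrightarrow> polynomial_map Q \<Longrightarrow> polynomial_map (\<lambda>w. P w - Q w)"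
  using polynomial_map.add[OF _ polynomial_map.mult[OF polynomial_map.const[of "- 1"]]] by simp

lemma polynomial_map_prod:
  "(\<And>i. i \<in> I \<Longrightarrow> polynomial_map (P i)) \<Longrightarrow> polynomial_map (\<lambda>w. \<Prod>i\<in>I. P i w)"
  by (induction I rule: infinite_finite_induct) (auto intro: polynomial_map.intros)

lemma polynomial_map_ratio_at:
  "polynomial_map (\<lambda>w. fst (ratio_at D w q))" "polynomial_map (\<lambda>w. snd (ratio_at D w q))"
proof -
  obtain j x where q: "q = (j, x)" by force
  show "polynomial_map (\<lambda>w. fst (ratio_at D w q))" "polynomial_map (\<lambda>w. snd (ratio_at D w q))"
    by (cases "positive D j"; cases x; simp add: q polynomial_map_diff polynomial_map.intros)+
qed

lemma polynomial_map_line: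
  assumes "polynomial_map P"
  shows "\<exists>p. \<forall>t. P (\<lambda>k. u k + t * d k) = poly p t"
  using assms
proof induction
  case (const c)
  show ?case by (rule exI[of _ "[:c:]"]) simp
next
  case (var k)
  show ?case by (rule exI[of _ "[:u k, d k:]"]) simp
next
  case (add P Q)
  then show ?case by (metis poly_add)
next
  case (mult P Q)
  then show ?case by (metis poly_mult)
qed

lemma principal_domain_line:
  fixes D :: "('c::finite, 'r) diagram"
  assumes "v \<in> principal_domain D"
  shows "\<forall>\<^sub>F t in at 0. (\<lambda>k. v k + t * d k) \<in> principal_domain D"
proof -
  have nonreal: "\<forall>\<^sub>F t in at 0. h t \<notin> \<real>" if "isCont h 0" "h 0 \<notin> \<real>" for h :: "complex \<Rightarrow> complex"
    using that tendsto_imp_eventually_ne[of "\<lambda>t. Im (h t)" "Im (h 0)" "at 0" 0]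
    by (simp add: isCont_def tendsto_Im complex_is_Real_iff)
  have "\<forall>\<^sub>F t in at 0. (\<lambda>k. v k + t * d k) \<in> principal_domain_at D j" for j
  proof -
    have dom: "v \<in> principal_domain_at D j" using assms by (simp add: principal_domain_def)
    note dom' = dom[unfolded principal_domain_at_def mem_Collect_eq Let_def]
    have nz: "v (region D (j, x)) \<noteq> 0" for x
      using dom' by (cases x) auto
    show ?thesis
      using dom' nz
      by (auto simp: principal_domain_at_def Let_def eventually_conj_iff intro!: nonreal continuous_intros)
  qed
  then show ?thesis by (simp add: principal_domain_def eventually_ball_finite_distrib eventually_all_finite)
qed

text \<open>On the line from a point of the domain to \<open>w\<close> the map is a polynomial in
  one variable. It vanishes near the starting point, hence identically, and parameter 1 gives
  \<open>w\<close>.\<close>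

lemma polynomial_map_eq_zero:
  fixes D :: "('c::finite, 'r) diagram"
  assumes P: "polynomial_map P" "\<And>v. v \<in> principal_domain D \<Longrightarrow> P v = 0" and ne: "principal_domain D \<noteq> {}"
  shows "P w = 0"
proof -
  obtain v where v: "v \<in> principal_domain D" using ne by blast
  obtain p where p: "\<And>t. P (\<lambda>k. v k + t * (w k - v k)) = poly p t"
    using polynomial_map_line[OF P(1), of v "\<lambda>k. w k - v k"] by blast
  have zero: "\<forall>\<^sub>F t in at 0. poly p t = 0"
    using principal_domain_line[OF v, of "\<lambda>k. w k - v k"] by eventually_elim (metis p P(2))
  have "p = 0"
  proof (rule ccontr)
    assume "p \<noteq> 0"
    then have "\<not> (0 :: complex) islimpt {t. poly p t = 0}"
      using islimpt_finite poly_roots_finite by blast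
    then have "\<forall>\<^sub>F t in at 0. poly p t \<noteq> 0" by (simp add: islimpt_iff_eventually)
    with zero have "\<forall>\<^sub>F t in at (0 :: complex). False" by eventually_elim simp
    then show False by simp
  qed
  then show ?thesis using p[of 1] by simp
qed

text \<open>Cross-multiplying the unknown representation with \<open>N / M\<close> gives a
  polynomial identity, which extends to every point. The conclusion keeps its content when
  \<open>M w = 0\<close>: then \<open>N w = 0\<close> too.\<close>

lemma rational_value_quotient:
  fixes D :: "('c::finite, 'r) diagram"
  assumes ne: "principal_domain D \<noteq> {}" and sub: "principal_domain D \<subseteq> G"
    and N: "polynomial_map N" and M: "polynomial_map M"
    and M0: "\<And>v. v \<in> principal_domain D \<Longrightarrow> M v \<noteq> 0"
    and f: "\<And>v. v \<in> principal_domain D \<Longrightarrow> f v = N v / M v"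
    and val: "rational_value G f w x"
  shows "N w = x * M w"
proof -
  obtain P Q where PQ: "polynomial_map P" "polynomial_map Q" "Q w \<noteq> 0"
    "\<And>v. v \<in> G \<Longrightarrow> f v * Q v = P v" "x = P w / Q w"
    using val unfolding rational_value_def by blast
  have "N w * Q w - P w * M w = 0"
  proof (rule polynomial_map_eq_zero[where D = D and P = "\<lambda>w. N w * Q w - P w * M w"])
    show "polynomial_map (\<lambda>w. N w * Q w - P w * M w)"
      by (intro polynomial_map_diff polynomial_map.intros N M PQ)
    show "N v * Q v - P v * M v = 0" if "v \<in> principal_domain D" for v
      using PQ(4)[of v] sub M0[OF that] f[OF that] that by (auto simp: field_simps)
  qed fact
  then have "N w * Q w = x * M w * Q w" using PQ(3,5) by simp
  then show ?thesis using PQ(3) by simp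
qed

subsection \<open>Combinatorics of diagrams\<close>

lemma UNIV_strand: "(UNIV :: strand set) = {Over, Under}"
  using strand.exhaust by auto

instance strand :: finite
  by standard (simp add: UNIV_strand)

lemma CARD_strand: "CARD(strand) = 2"
  by (simp add: UNIV_strand)

lemma CARD_corner: "CARD(corner) = 4"
  by (simp add: UNIV_corner)

abbreviation pred :: "('c, 'r) diagram \<Rightarrow> 'c edge \<Rightarrow> 'c edge" where
  "pred D \<equiv> inv (succ D)"

lemma succ_pred:
  assumes "link_diagram D"
  shows "succ D (pred D q) = q" "pred D (succ D q) = q"
  using assms by (auto simp: link_diagram_def bij_def surj_f_inv_f)

lemma region_in:
  assumes "link_diagram D"
  shows "region D (in_left D (succ D e)) = left_region D e"
    "region D (in_right D (succ D e)) = right_region D e"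
proof -
  have "\<forall>x y. corner_joined D x y \<longrightarrow> region D x = region D y"
    using assms by (simp add: link_diagram_def)
  then show "region D (in_left D (succ D e)) = left_region D e"
    "region D (in_right D (succ D e)) = right_region D e"
    unfolding corner_joined_def left_region_def right_region_def by metis+
qed

lemmas corner_defs = out_left_def out_right_def in_left_def in_right_def rising_def

lemma region_pred:
  assumes "link_diagram D"
  shows "left_region D (pred D q) = region D (in_left D q)"
    "right_region D (pred D q) = region D (in_right D q)"
  using region_in[OF assms, of "pred D q"] succ_pred[OF assms] by simp_all

lemma edge_regions:
  assumes "link_diagram D"
  shows "left_region D (j, t) = region D (j, if positive D j \<longleftrightarrow> t = Over then North else West)"
    "right_region D (j, t) = region D (j, if positive D j \<longleftrightarrow> t = Over then East else North)"
    "left_region D (pred D (j, t)) = region D (j, if positive D j \<longleftrightarrow> t = Over then West else South)"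
    "right_region D (pred D (j, t)) = region D (j, if positive D j \<longleftrightarrow> t = Over then South else East)"
  unfolding region_pred[OF assms] by (simp_all add: left_region_def right_region_def corner_defs)

lemma essential_corners:
  assumes "link_diagram D" "essential D w"
  shows "at_corners D w j (\<lambda>a b c d. a \<noteq> 0 \<and> b \<noteq> 0 \<and> c \<noteq> 0 \<and> d \<noteq> 0 \<and>
    a \<noteq> b \<and> b \<noteq> c \<and> c \<noteq> d \<and> a \<noteq> d)"
proof -
  have lr: "w (left_region D e) \<noteq> w (right_region D e)" "w k \<noteq> 0" for e k
    using assms(2) unfolding essential_def by blast+
  show ?thesis
    using lr(1)[of "(j, Over)"] lr(1)[of "(j, Under)"]
      lr(1)[of "pred D (j, Over)"] lr(1)[of "pred D (j, Under)"]
    by (auto simp: lr(2) edge_regions[OF assms(1)] split: if_splits)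
qed

text \<open>With V crossings and C components there are 2V edges. Genus zero gives V + 2C faces, and
  the tree condition turns these into V + C + 1 regions.\<close>

lemma card_regions:
  fixes D :: "('c::finite, 'r::finite) diagram"
  assumes "link_diagram D"
  shows "CARD('r) = CARD('c) + card (components D) + 1"
proof -
  have "CARD('c edge) = 2 * CARD('c)" by (simp add: CARD_strand)
  then show ?thesis using assms unfolding link_diagram_def by linarith
qed

section \<open>Connectivity of crossings and regions\<close>

lemma equivclp_closed:
  assumes "equivclp P x y" "\<And>a b. P a b \<Longrightarrow> a \<in> U \<longleftrightarrow> b \<in> U"
  shows "x \<in> U \<longleftrightarrow> y \<in> U"
  using assms(1) by (induction rule: equivclp_induct) (use assms(2) in blast)+

text \<open>The crossing graph may be disconnected, so its spanning forests are rooted at one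
  crossing per component.\<close>

lemma component_representatives:
  fixes D :: "('c::finite, 'r) diagram"
  obtains R where "card R \<le> card (components D)"
    "\<And>U. R \<subseteq> U \<Longrightarrow> (\<And>e. fst e \<in> U \<longleftrightarrow> fst (succ D e) \<in> U) \<Longrightarrow> U = UNIV"
proof
  let ?R = "(\<lambda>K. SOME j. j \<in> K) ` components D"
  show "card ?R \<le> card (components D)" by (simp add: card_image_le)
  fix U assume R: "?R \<subseteq> U" and U: "\<And>e. fst e \<in> U \<longleftrightarrow> fst (succ D e) \<in> U"
  have joined: "a \<in> U \<longleftrightarrow> b \<in> U" if "crossing_joined D a b" for a b
    using that U unfolding crossing_joined_def by (metis fst_conv)
  have "j \<in> U" for j
  proof -
    let ?K = "{(j, j'). equivclp (crossing_joined D) j j'} `` {j}"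
    have "?K \<in> components D" unfolding components_def by (rule quotientI) simp
    then have "(SOME i. i \<in> ?K) \<in> U" using R by blast
    moreover have "(SOME i. i \<in> ?K) \<in> ?K" by (rule someI[of _ j]) simp
    ultimately show ?thesis using equivclp_closed[of "crossing_joined D" j _ U] joined by auto
  qed
  then show "U = UNIV" by blast
qed

text \<open>\<open>U\<close> and \<open>V\<close> together are closed under incidence of crossings
  with regions, and the incidence graph is connected even if the crossing graph is not.\<close>

lemma crossings_cut:
  assumes D: "link_diagram D" and U: "\<And>j x. j \<in> U \<longleftrightarrow> region D (j, x) \<in> V"
    and ne: "k \<in> V"
  shows "U = UNIV" "V = UNIV"
proof -
  have surj: "\<exists>j x. region D (j, x) = m" for m
    using D unfolding link_diagram_def surj_def by (metis surj_pair)
  have eq: "equivclp (\<lambda>i i'. \<exists>x x'. region D (i, x) = region D (i', x')) i i'" for i i'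
    using D unfolding link_diagram_def by blast
  obtain j0 where j0: "j0 \<in> U" using surj[of k] ne U by metis
  have "j \<in> U" for j
    using equivclp_closed[OF eq[of j0 j], of U] j0 U by metis
  then show "U = UNIV" by blast
  then show "V = UNIV" using surj U by (metis UNIV_I UNIV_eq_I)
qed

lemma regions_cut:
  assumes D: "link_diagram D" and V: "\<And>e. right_region D e \<in> V \<longleftrightarrow> left_region D e \<in> V"
    and ne: "k \<in> V"
  shows "V = UNIV"
proof (rule crossings_cut(2)[OF D _ ne])
  fix j x
  show "j \<in> {j. region D (j, North) \<in> V} \<longleftrightarrow> region D (j, x) \<in> V"
    using V[of "(j, Over)"] V[of "(j, Under)"] V[of "pred D (j, Over)"] V[of "pred D (j, Under)"]
    by (cases x; auto simp: edge_regions[OF D] split: if_splits)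
qed

section \<open>Integration of cochains on a diagram\<close>

lemma edges_from: "{e :: 'c edge. fst e = j} = {(j, Over), (j, Under)}"
proof (rule set_eqI)
  fix e :: "'c edge"
  show "e \<in> {e. fst e = j} \<longleftrightarrow> e \<in> {(j, Over), (j, Under)}"
    by (cases e; cases "snd e") auto
qed

lemma edges_into:
  assumes "link_diagram D"
  shows "{e. fst (succ D e) = j} = {pred D (j, Over), pred D (j, Under)}"
proof -
  have "{e. fst (succ D e) = j} = pred D ` {e. fst e = j}"
  proof (intro set_eqI iffI)
    fix e assume "e \<in> {e. fst (succ D e) = j}"
    then show "e \<in> pred D ` {e. fst e = j}"
      by (intro image_eqI[of _ _ "succ D e"]) (simp_all add: succ_pred[OF assms])
  qed (auto simp: succ_pred[OF assms])
  then show ?thesis by (simp add: edges_from)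
qed

lemma sum_edges_from: "(\<Sum>e | fst e = j. f e) = f (j, Over) + f (j, Under)"
  by (simp add: edges_from)

lemma sum_edges_into:
  assumes "link_diagram D"
  shows "(\<Sum>e | fst (succ D e) = j. f e) = f (pred D (j, Over)) + f (pred D (j, Under))"
proof -
  have "pred D (j, Over) \<noteq> pred D (j, Under)" using succ_pred(1)[OF assms] by (metis Pair_inject strand.distinct(1))
  then show ?thesis by (simp add: edges_into[OF assms])
qed

text \<open>Exactness on the dual graph: regions are the vertices, each edge leads from its right to
  its left region, and its two end crossings are the 2-cells beside it. The count is
  \<open>2V + 1 + C = (V + C + 1) + V\<close>.\<close>

lemma integrate_over_regions:
  fixes D :: "('c::finite, 'r::finite) diagram" and f :: "'c edge \<Rightarrow> 'a::ab_group_add"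
  assumes D: "link_diagram D"
    and closed: "\<And>j. f (j, Over) + f (j, Under) = f (pred D (j, Over)) + f (pred D (j, Under))"
  shows "\<exists>g. \<forall>e. f e = g (left_region D e) - g (right_region D e)"
proof -
  obtain R where R: "card R \<le> card (components D)"
    "\<And>U. R \<subseteq> U \<Longrightarrow> (\<And>e. fst e \<in> U \<longleftrightarrow> fst (succ D e) \<in> U) \<Longrightarrow> U = UNIV"
    using component_representatives by blast
  obtain k :: 'r where True by simp
  show ?thesis
  proof (rule closed_imp_exact[where lft = fst and tgt = "left_region D" and
        src = "right_region D" and rgt = "\<lambda>e. fst (succ D e)" and R = "{k}" and R' = R and f = f])
    show "(\<Sum>e | fst e = j. g (left_region D e) - g (right_region D e)) =
      (\<Sum>e | fst (succ D e) = j. g (left_region D e) - g (right_region D e))" for j and g :: "'r \<Rightarrow> 'a"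
      by (simp add: sum_edges_from sum_edges_into[OF D] edge_regions[OF D])
    show "U = UNIV" if "{k} \<subseteq> U" "\<And>e. right_region D e \<in> U \<longleftrightarrow> left_region D e \<in> U" for U
      using regions_cut[OF D, of U k] that by blast
    show "U = UNIV" if "R \<subseteq> U" "\<And>e. fst (succ D e) \<in> U \<longleftrightarrow> fst e \<in> U" for U
      using R(2)[OF that(1)] that(2) by blast
    show "CARD('c edge) + card {k} + card R \<le> CARD('r) + CARD('c)"
      using R(1) card_regions[OF D] by (simp add: CARD_strand)
    show "(\<Sum>e | fst e = j. f e) = (\<Sum>e | fst (succ D e) = j. f e)" for j
      using closed by (simp add: sum_edges_from sum_edges_into[OF D])
  qed
qed

text \<open>Every corner joins the two edges beside it, in the clockwise sense around the crossing.\<close>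

definition rise :: "('c, 'r) diagram \<Rightarrow> 'c \<Rightarrow> 'c edge" where
  "rise D j = (j, if positive D j then Over else Under)"
definition fall :: "('c, 'r) diagram \<Rightarrow> 'c \<Rightarrow> 'c edge" where
  "fall D j = (j, if positive D j then Under else Over)"

fun edge_before :: "('c, 'r) diagram \<Rightarrow> 'c \<times> corner \<Rightarrow> 'c edge" where
  "edge_before D (j, South) = pred D (fall D j)"
| "edge_before D (j, West) = pred D (rise D j)"
| "edge_before D (j, North) = fall D j"
| "edge_before D (j, East) = rise D j"

fun edge_after :: "('c, 'r) diagram \<Rightarrow> 'c \<times> corner \<Rightarrow> 'c edge" where
  "edge_after D (j, South) = pred D (rise D j)"
| "edge_after D (j, West) = fall D j"
| "edge_after D (j, North) = rise D j"
| "edge_after D (j, East) = pred D (fall D j)"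

text \<open>On either side of an edge, the edge is \<open>edge_after\<close> at one end and
  \<open>edge_before\<close> at the other, and both corners lie in the same region, so everything
  cancels. The argument is local to edges and thus covers regions with several boundary
  walks.\<close>

lemma sum_around_region:
  fixes D :: "('c::finite, 'r::finite) diagram" and g :: "'c edge \<Rightarrow> 'a::ab_group_add"
  assumes D: "link_diagram D"
  shows "(\<Sum>q | region D q = k. g (edge_after D q) - g (edge_before D q)) = 0"
proof -
  define h where "h q y = (if region D q = k then y else 0)" for q and y :: 'a
  have h_diff: "h q (y - z) = h q y - h q z" for q y z by (simp add: h_def)
  have h_in: "h (in_left D (succ D e)) = h (out_left D e)" "h (in_right D (succ D e)) = h (out_right D e)" for e
    unfolding h_def region_in[OF D] by (simp_all add: left_region_def right_region_def)
  have "(\<Sum>q | region D q = k. g (edge_after D q) - g (edge_before D q))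
      = (\<Sum>q\<in>UNIV. h q (g (edge_after D q) - g (edge_before D q)))"
    by (simp add: h_def sum.If_cases)
  also have "\<dots> = (\<Sum>j\<in>UNIV. \<Sum>x\<in>UNIV. h (j, x) (g (edge_after D (j, x)) - g (edge_before D (j, x))))"
    by (simp add: sum.cartesian_product)
  \<comment> \<open>Regroup the corners of each crossing by the edge ends that they touch.\<close>
  also have "\<dots> = (\<Sum>j\<in>UNIV. \<Sum>t\<in>UNIV.
      (h (out_left D (j, t)) (g (j, t)) - h (out_right D (j, t)) (g (j, t))) +
      (h (in_right D (j, t)) (g (pred D (j, t))) - h (in_left D (j, t)) (g (pred D (j, t)))))"
    by (intro sum.cong refl)
       (simp add: UNIV_strand UNIV_corner corner_defs rise_def fall_def h_diff algebra_simps)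
  also have "\<dots> = (\<Sum>q\<in>UNIV.
      (h (out_left D q) (g q) - h (out_right D q) (g q)) +
      (h (in_right D q) (g (pred D q)) - h (in_left D q) (g (pred D q))))"
    by (simp add: sum.cartesian_product)
  also have "\<dots> = (\<Sum>q\<in>UNIV. h (out_left D q) (g q) - h (out_right D q) (g q)) +
      (\<Sum>q\<in>UNIV. h (in_right D q) (g (pred D q)) - h (in_left D q) (g (pred D q)))"
    by (rule sum.distrib)
  also have "(\<Sum>q\<in>UNIV. h (in_right D q) (g (pred D q)) - h (in_left D q) (g (pred D q)))
      = (\<Sum>e\<in>UNIV. h (in_right D (succ D e)) (g (pred D (succ D e))) - h (in_left D (succ D e)) (g (pred D (succ D e))))"
    using D by (intro sum.reindex_bij_betw[symmetric]) (simp add: link_diagram_def)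
  finally show ?thesis by (simp add: succ_pred[OF D] h_in flip: sum.distrib)
qed

text \<open>Exactness on the medial graph: edges of the diagram are the vertices, and corners are
  the 1-cells, each with a crossing on one side and a region on the other. Every 2-cell lies on one
  side only, so closedness means that the sum around it is zero. The count is
  \<open>4V + C + 1 = 2V + (V + V + C + 1)\<close>.\<close>

lemma integrate_over_edges:
  fixes D :: "('c::finite, 'r::finite) diagram" and f :: "'c \<times> corner \<Rightarrow> 'a::ab_group_add"
  assumes D: "link_diagram D"
    and crossing: "\<And>j. (\<Sum>x\<in>UNIV. f (j, x)) = 0"
    and region: "\<And>k. (\<Sum>q | region D q = k. f q) = 0"
  shows "\<exists>g. \<forall>q. f q = g (edge_after D q) - g (edge_before D q)"
proof -
  obtain R where R: "card R \<le> card (components D)"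
    "\<And>U. R \<subseteq> U \<Longrightarrow> (\<And>e. fst e \<in> U \<longleftrightarrow> fst (succ D e) \<in> U) \<Longrightarrow> U = UNIV"
    using component_representatives by blast
  let ?R = "(\<lambda>j. (j, Over)) ` R"
  obtain k :: 'r where True by simp
  have around: "(\<Sum>q | fst q = j. a q) = (\<Sum>x\<in>UNIV. a (j, x))" for a :: "'c \<times> corner \<Rightarrow> 'a" and j
  proof -
    have "{q :: 'c \<times> corner. fst q = j} = Pair j ` UNIV" by auto
    then show ?thesis by (simp add: sum.reindex inj_on_def)
  qed
  show ?thesis
  proof (rule closed_imp_exact[where lft = "\<lambda>q. Inl (fst q) :: 'c + 'r" and tgt = "edge_after D" and
        src = "edge_before D" and rgt = "\<lambda>q. Inr (region D q)" and R = ?R and R' = "{Inr k}" and f = f])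
    show "(\<Sum>q | Inl (fst q) = y. g (edge_after D q) - g (edge_before D q)) =
      (\<Sum>q | Inr (region D q) = y. g (edge_after D q) - g (edge_before D q))"
      for g :: "'c edge \<Rightarrow> 'a" and y :: "'c + 'r"
    proof (cases y)
      case (Inl j)
      then show ?thesis by (simp add: around) (simp add: UNIV_corner)
    next
      case (Inr m)
      then show ?thesis by (simp add: sum_around_region[OF D])
    qed
    show "U = UNIV" if "?R \<subseteq> U" and U: "\<And>q. edge_before D q \<in> U \<longleftrightarrow> edge_after D q \<in> U" for U
    proof -
      have out: "(j, t) \<in> U \<longleftrightarrow> (j, Over) \<in> U" for j t
        using U[of "(j, North)"] by (cases t) (auto simp: rise_def fall_def split: if_splits)
      have into: "pred D (j, t) \<in> U \<longleftrightarrow> (j, Over) \<in> U" for j t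
        using U[of "(j, West)"] U[of "(j, East)"] out
        by (cases t) (auto simp: rise_def fall_def split: if_splits)
      have "{j. (j, Over) \<in> U} = UNIV"
      proof (rule R(2))
        show "fst e \<in> {j. (j, Over) \<in> U} \<longleftrightarrow> fst (succ D e) \<in> {j. (j, Over) \<in> U}" for e
          using out[of "fst e" "snd e"] into[of "fst (succ D e)" "snd (succ D e)"]
          by (simp add: succ_pred[OF D])
      qed (use that(1) in auto)
      then show ?thesis using out by auto
    qed
    show "U = UNIV" if "{Inr k} \<subseteq> U" and U: "\<And>q. Inr (region D q) \<in> U \<longleftrightarrow> Inl (fst q) \<in> U"
      for U :: "('c + 'r) set"
    proof -
      have "j \<in> {j. Inl j \<in> U} \<longleftrightarrow> region D (j, x) \<in> {m. Inr m \<in> U}" for j x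
        using U[of "(j, x)"] by simp
      from crossings_cut[OF D this, of k] that(1)
      have "Inl j \<in> U" "Inr m \<in> U" for j m by auto
      then have "y \<in> U" for y by (cases y) auto
      then show ?thesis by blast
    qed
    have "card ?R = card R" by (rule card_image) (simp add: inj_on_def)
    then show "CARD('c \<times> corner) + card ?R + card {Inr k :: 'c + 'r} \<le> CARD('c edge) + CARD('c + 'r)"
      using R(1) card_regions[OF D] by (simp add: CARD_strand CARD_corner card_UNIV_sum)
    show "(\<Sum>q | Inl (fst q) = y. f q) = (\<Sum>q | Inr (region D q) = y. f q)" for y :: "'c + 'r"
      by (cases y) (simp_all add: around crossing region)
  qed
qed

subsection \<open>The solution at a crossing\<close>

text \<open>The largest exponent occurs on one side only, and its power of 4 exceeds the sum of any
  two lower powers. Opposite exponents may coincide, as opposite corners may share a region.\<close>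

lemma power_sums_distinct:
  fixes a b c d :: nat
  assumes "a \<noteq> b" "b \<noteq> c" "c \<noteq> d" "a \<noteq> d"
  shows "(4::nat) ^ a + 4 ^ c \<noteq> 4 ^ b + 4 ^ d"
proof -
  have less: "(4::nat) ^ p + 4 ^ q < 4 ^ m" if pq: "p < m" "q < m" for p q m :: nat
  proof -
    obtain n where m: "m = Suc n" using pq(1) by (cases m) auto
    then have "p \<le> n" "q \<le> n" using pq by auto
    then have "(4::nat) ^ p \<le> 4 ^ n" "(4::nat) ^ q \<le> 4 ^ n"
      by (auto intro: power_increasing)
    moreover have "(0::nat) < 4 ^ n" by simp
    ultimately show ?thesis unfolding m power_Suc by linarith
  qed
  have "a > b \<and> a > d \<or> c > b \<and> c > d \<or> b > a \<and> b > c \<or> d > a \<and> d > c"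
    using assms by linarith
  then show ?thesis
    using less[of b a d] less[of b c d] less[of a b c] less[of a d c] by auto
qed

lemma cis_not_real:
  assumes "x \<noteq> 0" "\<bar>x\<bar> < 3"
  shows "cis x \<notin> \<real>"
proof -
  have "- pi < x" "x < pi" using assms(2) pi_gt3 by auto
  then have "sin x \<noteq> 0" using sin_eq_0_pi assms(1) by blast
  then show ?thesis by (simp add: complex_is_Real_iff)
qed

text \<open>The point lies on the unit circle, with powers of 4 scaled into \<open>(0, 1)\<close> as
  angles. Since regions on the two sides of an edge differ, every quotient in question has an angle
  that is nonzero and less than 3 in absolute value.\<close>

lemma principal_domain_nonempty:
  fixes D :: "('c::finite, 'r::finite) diagram"
  assumes "link_diagram D" "essential D w"
  shows "principal_domain D \<noteq> {}"
proof -
  obtain f :: "'r \<Rightarrow> nat" where f: "bij_betw f UNIV {0..<CARD('r)}"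
    using ex_bij_betw_finite_nat[OF finite_class.finite_UNIV] by blast
  define N :: real where "N = 4 ^ CARD('r)"
  define \<theta> where "\<theta> k = 4 ^ f k / N" for k
  have N: "N > 0" by (simp add: N_def)
  have \<theta>: "0 < \<theta> k" "\<theta> k < 1" for k
  proof -
    have "f k < CARD('r)" using f by (auto simp: bij_betw_def)
    then have "(4 :: real) ^ f k < N" unfolding N_def by (intro power_strict_increasing) auto
    then show "0 < \<theta> k" "\<theta> k < 1" using N by (auto simp: \<theta>_def)
  qed
  have inj: "f k = f m \<longleftrightarrow> k = m" for k m
    using f by (auto simp: bij_betw_def inj_on_def)
  have one: "cis (\<theta> k) / cis (\<theta> m) \<notin> \<real>" if "k \<noteq> m" for k m
  proof -
    have "\<theta> k - \<theta> m \<noteq> 0" using N inj[of k m] that by (simp add: \<theta>_def)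
    then show ?thesis using \<theta>[of k] \<theta>[of m] unfolding cis_divide by (intro cis_not_real) auto
  qed
  have two: "cis (\<theta> a) * cis (\<theta> c) / (cis (\<theta> b) * cis (\<theta> d)) \<notin> \<real>"
    if "a \<noteq> b" "b \<noteq> c" "c \<noteq> d" "a \<noteq> d" for a b c d
  proof -
    have "(4::nat) ^ f a + 4 ^ f c \<noteq> 4 ^ f b + 4 ^ f d"
      using that by (intro power_sums_distinct) (auto simp: inj)
    then have "real (4 ^ f a + 4 ^ f c) \<noteq> real (4 ^ f b + 4 ^ f d)" by (metis of_nat_eq_iff)
    then have "\<theta> a + \<theta> c \<noteq> \<theta> b + \<theta> d" using N by (simp add: \<theta>_def flip: add_divide_distrib)
    then show ?thesis
      using \<theta>[of a] \<theta>[of b] \<theta>[of c] \<theta>[of d] unfolding cis_divide cis_mult by (intro cis_not_real) auto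
  qed
  have "(\<lambda>k. cis (\<theta> k)) \<in> principal_domain_at D j" for j
  proof -
    have ne: "region D (j, North) \<noteq> region D (j, West)" "region D (j, West) \<noteq> region D (j, South)"
      "region D (j, South) \<noteq> region D (j, East)" "region D (j, North) \<noteq> region D (j, East)"
      using essential_corners[OF assms, of j] by auto
    show ?thesis
      by (simp add: principal_domain_at_def Let_def one two ne ne[THEN not_sym])
  qed
  then show ?thesis by (auto simp: principal_domain_def)
qed

text \<open>This is where the factors of each single crossing must be defined: a finite value
  excludes a zero denominator once the numerator is known not to vanish at an essential
  point.\<close>

lemma solution_branch_free:
  fixes D :: "('c::finite, 'r::finite) diagram"
  assumes D: "link_diagram D" and sol: "hyperbolicity_solution D w" and ess: "essential D w"
  shows "at_corners D w j (\<lambda>a b c d. b * d - a * c \<noteq> 0)"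
proof
  assume branch: "at_corners D w j (\<lambda>a b c d. b * d - a * c = 0)"
  define x where "x = (if positive D j then North else West)"
  \<comment> \<open>At \<open>x\<close> the vanishing \<open>b d - a c\<close> is a denominator; opposite corners may share a region, but
    their factors have the same denominator, so no cancellation occurs.\<close>
  let ?I = "{y. region D (j, y) = region D (j, x)}"
  obtain v where "rational_value (principal_domain_at D j)
      (exp_log_deriv (potential_at D j) (region D (j, x))) w v"
    using sol unfolding hyperbolicity_solution_def hyperbolicity_defined_def by blast
  then have eq: "(\<Prod>y\<in>?I. fst (ratio_at D w (j, y))) = v * (\<Prod>y\<in>?I. snd (ratio_at D w (j, y)))"
  proof (rule rational_value_quotient[OF principal_domain_nonempty[OF D ess], rotated -1])
    fix u assume u: "u \<in> principal_domain D"
    then have u': "u \<in> principal_domain_at D j" by (simp add: principal_domain_def)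
    show "(\<Prod>y\<in>?I. snd (ratio_at D u (j, y))) \<noteq> 0"
      using ratio_at_nonzero[of u D "(j, _)"] u' by simp
    show "exp_log_deriv (potential_at D j) (region D (j, x)) u =
        (\<Prod>y\<in>?I. fst (ratio_at D u (j, y))) / (\<Prod>y\<in>?I. snd (ratio_at D u (j, y)))"
      by (simp add: exp_log_deriv_potential_at[OF u'] factor_at_def prod_dividef)
  qed (auto simp: principal_domain_def simp del: ratio_at.simps intro!: polynomial_map_prod polynomial_map_ratio_at)
  note ne = essential_corners[OF D ess, of j]
  have "fst (ratio_at D w (j, y)) \<noteq> 0" if "y \<in> ?I" for y
  proof -
    have "w (region D (j, y)) = w (region D (j, x))" using that by simp
    \<comment> \<open>Adjacent corners carry different values of \<open>w\<close>, so only
      \<open>x\<close> and the corner opposite to it can belong to \<open>?I\<close>.\<close>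
    then show ?thesis using ne by (cases "positive D j"; cases y; simp add: x_def; metis)
  qed
  then have "(\<Prod>y\<in>?I. fst (ratio_at D w (j, y))) \<noteq> 0" by (simp del: ratio_at.simps)
  moreover have "snd (ratio_at D w (j, x)) = 0" using branch by (simp add: x_def)
  then have "(\<Prod>y\<in>?I. snd (ratio_at D w (j, y))) = 0" by (intro prod_zero) auto
  ultimately show False using eq by (metis mult_zero_right)
qed

lemma corner_factor_nonzero:
  assumes "a \<noteq> b" "b \<noteq> c" "c \<noteq> d" "a \<noteq> d" "b * d - a * c \<noteq> 0"
  shows "fst (corner_factor x a b c d) \<noteq> 0" "snd (corner_factor x a b c d) \<noteq> 0"
  using assms by (cases x; simp)+

lemma solution_ratio_nonzero:
  fixes D :: "('c::finite, 'r::finite) diagram"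
  assumes "link_diagram D" "hyperbolicity_solution D w" "essential D w"
  shows "fst (ratio_at D w q) \<noteq> 0" "snd (ratio_at D w q) \<noteq> 0"
proof -
  obtain j x where "q = (j, x)" by force
  then show "fst (ratio_at D w q) \<noteq> 0" "snd (ratio_at D w q) \<noteq> 0"
    using corner_factor_nonzero[of "w (region D (j, North))" "w (region D (j, West))"
      "w (region D (j, South))" "w (region D (j, East))" x]
      essential_corners[OF assms(1,3), of j] solution_branch_free[OF assms, of j]
    by simp_all
qed

lemma solution_region:
  fixes D :: "('c::finite, 'r::finite) diagram"
  assumes D: "link_diagram D" and sol: "hyperbolicity_solution D w" and ess: "essential D w"
  shows "(\<Prod>q | region D q = k. factor_at D w q) = 1"
proof -
  have "rational_value (principal_domain D) (exp_log_deriv (potential D) k) w 1"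
    using sol unfolding hyperbolicity_solution_def by blast
  then have "(\<Prod>q | region D q = k. fst (ratio_at D w q)) = 1 * (\<Prod>q | region D q = k. snd (ratio_at D w q))"
  proof (rule rational_value_quotient[OF principal_domain_nonempty[OF D ess], rotated -1])
    fix u assume u: "u \<in> principal_domain D"
    show "(\<Prod>q | region D q = k. snd (ratio_at D u q)) \<noteq> 0"
      using ratio_at_nonzero(2)[of u D] u by (simp add: principal_domain_def)
    show "exp_log_deriv (potential D) k u =
        (\<Prod>q | region D q = k. fst (ratio_at D u q)) / (\<Prod>q | region D q = k. snd (ratio_at D u q))"
      by (simp add: exp_log_deriv_potential[OF u] factor_at_def prod_dividef)
  qed (auto intro!: polynomial_map_prod polynomial_map_ratio_at)
  then show ?thesis
    by (simp add: factor_at_def prod_dividef solution_ratio_nonzero[OF assms])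
qed

text \<open>The potential of a crossing is invariant under a common scaling of its variables, so its
  logarithmic derivatives add up to 0. The proof checks the resulting cancellation on the explicit
  factors.\<close>

lemma solution_crossing:
  fixes D :: "('c::finite, 'r::finite) diagram"
  assumes "link_diagram D" "hyperbolicity_solution D w" "essential D w"
  shows "(\<Prod>x\<in>UNIV. factor_at D w (j, x)) = 1"
proof -
  have cancel: "p * q / k * (r * s / k * (k / (r * p) * (k / (s * q)))) = 1"
    "k / (p * q) * (k / (r * s) * (r * p / k * (s * q / k))) = 1"
    if "p \<noteq> 0" "q \<noteq> 0" "r \<noteq> 0" "s \<noteq> 0" "k \<noteq> 0" for p q r s k :: complex
    using that by simp_all
  note ne = essential_corners[OF assms(1,3), of j] solution_branch_free[OF assms, of j]
  have "(\<Prod>x\<in>UNIV. h x) = h North * (h South * (h West * h East))" for h :: "corner \<Rightarrow> complex"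
    by (simp add: UNIV_corner)
  then show ?thesis
    by (cases "positive D j"; simp only: factor_at_def ratio_at.simps corner_factor.simps if_True if_False
      id_apply prod.swap_def swap_simp fst_conv snd_conv)
      (rule cancel; use ne in auto)+
qed

text \<open>The multiplicative group of complex numbers, written additively to serve as coefficient group.\<close>

typedef nonzero = "{z :: complex. z \<noteq> 0}" morphisms of_nonzero Nonzero
  by (rule exI[of _ 1]) simp

lemma of_nonzero_nonzero: "of_nonzero x \<noteq> 0"
  using of_nonzero[of x] by simp

instantiation nonzero :: ab_group_add
begin

definition "0 = Nonzero 1"
definition "x + y = Nonzero (of_nonzero x * of_nonzero y)"
definition "- x = Nonzero (inverse (of_nonzero x))"
definition "x - y = Nonzero (of_nonzero x / of_nonzero y)"

lemma of_nonzero_simps: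
  "of_nonzero 0 = 1" "of_nonzero (x + y) = of_nonzero x * of_nonzero y"
  "of_nonzero (- x) = inverse (of_nonzero x)" "of_nonzero (x - y) = of_nonzero x / of_nonzero y"
  by (simp_all add: zero_nonzero_def plus_nonzero_def uminus_nonzero_def minus_nonzero_def
      Nonzero_inverse of_nonzero_nonzero)

instance
  by standard (simp_all add: of_nonzero_simps of_nonzero_nonzero field_simps flip: of_nonzero_inject)

end

lemma of_nonzero_sum: "of_nonzero (sum f A) = (\<Prod>x\<in>A. of_nonzero (f x))"
  by (induction A rule: infinite_finite_induct) (simp_all add: of_nonzero_simps)

lemma integrate_ratios:
  fixes D :: "('c::finite, 'r::finite) diagram" and f :: "'c \<times> corner \<Rightarrow> complex"
  assumes D: "link_diagram D" and nz: "\<And>q. f q \<noteq> 0"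
    and crossing: "\<And>j. (\<Prod>x\<in>UNIV. f (j, x)) = 1"
    and region: "\<And>k. (\<Prod>q | region D q = k. f q) = 1"
  obtains g where "\<And>e. g e \<noteq> 0" "\<And>q. g (edge_after D q) = f q * g (edge_before D q)"
proof -
  have f: "of_nonzero (Nonzero (f q)) = f q" for q using nz by (simp add: Nonzero_inverse)
  have "\<exists>g. \<forall>q. Nonzero (f q) = g (edge_after D q) - g (edge_before D q)"
    by (rule integrate_over_edges[OF D])
       (simp_all add: of_nonzero_sum of_nonzero_simps f crossing region flip: of_nonzero_inject)
  then obtain g where "\<And>q. Nonzero (f q) = g (edge_after D q) - g (edge_before D q)" by blast
  then have "f q = of_nonzero (g (edge_after D q)) / of_nonzero (g (edge_before D q))" for q
    using f[of q] by (simp add: of_nonzero_simps)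
  then show ?thesis
    using that[of "\<lambda>e. of_nonzero (g e)"] by (simp add: of_nonzero_nonzero)
qed

text \<open>The variables \<open>sw\<close>, \<open>nw\<close>, \<open>ne\<close>, \<open>se\<close>
  are the values of \<open>\<mu>\<close> on the four edges, and the over-strand runs from
  \<open>sw\<close> to \<open>ne\<close>. The conclusions are closedness of the additive cochain and
  the two equalities that give both halves of the over-strand the same color: scale and fixed
  point.\<close>

lemma positive_crossing:
  fixes a b c d :: complex
  assumes "a \<noteq> 0" "b \<noteq> 0" "c \<noteq> 0" "d \<noteq> 0" "a \<noteq> b" "b \<noteq> c" "c \<noteq> d" "a \<noteq> d" "b * d - a * c \<noteq> 0"
    and W: "nw = (b * d - a * c) / ((b - c) * (a - b)) * sw"
    and N: "ne = (a - b) * (a - d) / (b * d - a * c) * nw"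
    and E: "se = (b * d - a * c) / ((d - c) * (a - d)) * ne"
  shows "ne * (1 / a - 1 / d) + nw * (1 / b - 1 / a) = sw * (1 / b - 1 / c) + se * (1 / c - 1 / d)"
    "ne / (a - d) = sw / (b - c)" "nw * (1 / b - 1 / a) = sw / b - ne / a"
proof -
  define l where "l = sw / (b - c)"
  have sw: "sw = l * (b - c)" using assms(6) by (simp add: l_def)
  have nw: "nw = l * (b * d - a * c) / (a - b)" unfolding W sw using assms(6) by simp
  have ne: "ne = l * (a - d)" unfolding N nw using assms(5,9) by simp
  have se: "se = l * (b * d - a * c) / (d - c)" unfolding E ne using assms(8) by simp
  show "ne / (a - d) = sw / (b - c)" using assms(6,8) by (simp add: ne sw)
  have 1: "nw * (1 / b - 1 / a) = l * (b * d - a * c) / (a * b)"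
    unfolding nw using assms(1,2,5) by (simp add: field_simps)
  have 2: "se * (1 / c - 1 / d) = l * (b * d - a * c) / (c * d)"
    unfolding se using assms(3,4,7) by (simp add: field_simps)
  show "nw * (1 / b - 1 / a) = sw / b - ne / a"
    unfolding 1 ne sw using assms(1,2) by (simp add: field_simps)
  show "ne * (1 / a - 1 / d) + nw * (1 / b - 1 / a) = sw * (1 / b - 1 / c) + se * (1 / c - 1 / d)"
    unfolding 1 2 unfolding ne sw using assms(1-4) by (simp add: field_simps)
qed

text \<open>The same three conclusions, with the over-strand running from \<open>se\<close> to
  \<open>nw\<close>.\<close>

lemma negative_crossing:
  fixes a b c d :: complex
  assumes "a \<noteq> 0" "b \<noteq> 0" "c \<noteq> 0" "d \<noteq> 0" "a \<noteq> b" "b \<noteq> c" "c \<noteq> d" "a \<noteq> d" "b * d - a * c \<noteq> 0"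
    and W: "nw = (b - c) * (a - b) / (b * d - a * c) * sw"
    and N: "ne = (b * d - a * c) / ((a - b) * (a - d)) * nw"
    and E: "se = (d - c) * (a - d) / (b * d - a * c) * ne"
  shows "ne * (1 / a - 1 / d) + nw * (1 / b - 1 / a) = sw * (1 / b - 1 / c) + se * (1 / c - 1 / d)"
    "nw / (b - a) = se / (c - d)" "sw * (1 / b - 1 / c) = nw / b - se / c"
proof -
  define l where "l = nw / (b - a)"
  have nw: "nw = l * (b - a)" using assms(5) by (simp add: l_def)
  have "sw = (b * d - a * c) / ((b - c) * (a - b)) * nw" unfolding W using assms(5,6,9) by simp
  also have "\<dots> = l * (a * c - b * d) / (b - c)"
    unfolding nw using assms(5,6) by (simp add: divide_simps) (simp add: algebra_simps)
  finally have sw: "sw = l * (a * c - b * d) / (b - c)" .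
  have ne: "ne = l * (a * c - b * d) / (a - d)" unfolding N nw using assms(5,8)
    by (simp add: divide_simps) (simp add: algebra_simps)
  have se: "se = l * (c - d)" unfolding E ne using assms(7,8,9)
    by (simp add: divide_simps) (simp add: algebra_simps)
  show "nw / (b - a) = se / (c - d)" using assms(5,7) by (simp add: nw se)
  have 1: "sw * (1 / b - 1 / c) = - l * (a * c - b * d) / (b * c)"
    unfolding sw using assms(2,3,6) by (simp add: field_simps)
  have 2: "ne * (1 / a - 1 / d) = - l * (a * c - b * d) / (a * d)"
    unfolding ne using assms(1,4,8) by (simp add: field_simps)
  show "sw * (1 / b - 1 / c) = nw / b - se / c"
    unfolding 1 nw se using assms(2,3) by (simp add: field_simps)
  show "ne * (1 / a - 1 / d) + nw * (1 / b - 1 / a) = sw * (1 / b - 1 / c) + se * (1 / c - 1 / d)"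
    unfolding 1 2 unfolding nw se using assms(1-4) by (simp add: field_simps)
qed

subsection \<open>Parabolic vectors\<close>

text \<open>The transvection form, from which the laws below are derived.\<close>

lemma vstar_eq: "vstar v a = v + (v $ 1 * a $ 2 - v $ 2 * a $ 1) *s a"
  by (simp add: vstar_def vec_eq_iff forall_2 vector_matrix_mult_def sum_2 vector_2 algebra_simps power2_eq_square)

lemma det2_eq: "det2 x y = x $ 1 * y $ 2 - x $ 2 * y $ 1"
  by (simp add: det2_def det_2 vector_2)

lemma vstar_minus: "vstar v (- a) = vstar v a" "vstar (- v) a = - vstar v a"
  by (simp_all add: vstar_eq vec_eq_iff forall_2 algebra_simps)

text \<open>Self-distributivity: acting by \<open>v\<close> is linear and preserves determinants, so
  it carries the transvection along \<open>u\<close> to the one along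
  \<open>vstar u v\<close>.\<close>

lemma vstar_vstar: "vstar (vstar s u) v = vstar (vstar s v) (vstar u v)"
  by (simp add: vstar_eq vec_eq_iff forall_2 algebra_simps)

text \<open>The displacements of \<open>s\<close> agree, \<open>x u = y u'\<close>. Their
  determinants with \<open>s\<close> give \<open>x\<^sup>2 = y\<^sup>2\<close>, and
  \<open>x \<noteq> 0\<close> because \<open>s\<close> is moved.\<close>

lemma vstar_cancel:
  assumes eq: "vstar s u = vstar s u'" and ne: "vstar s u \<noteq> s"
  shows "u' = u \<or> u' = - u"
proof -
  define x where "x = s $ 1 * u $ 2 - s $ 2 * u $ 1"
  define y where "y = s $ 1 * u' $ 2 - s $ 2 * u' $ 1"
  have "x *s u = y *s u'" using eq by (simp add: vstar_eq x_def y_def)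
  then have xy: "x * u $ 1 = y * u' $ 1" "x * u $ 2 = y * u' $ 2"
    by (simp_all add: vec_eq_iff)
  have "x \<noteq> 0" using ne by (auto simp: vstar_eq x_def)
  have "x * x = s $ 1 * (x * u $ 2) - s $ 2 * (x * u $ 1)" by (simp add: x_def algebra_simps)
  also have "\<dots> = y * y" by (simp add: xy y_def algebra_simps)
  finally have "y = x \<or> y = - x" by (metis square_eq_iff)
  then show ?thesis
  proof
    assume "y = x"
    then show ?thesis using xy \<open>x \<noteq> 0\<close> by (simp add: vec_eq_iff forall_2)
  next
    assume "y = - x"
    then have "x * (u' $ 1 + u $ 1) = 0" "x * (u' $ 2 + u $ 2) = 0"
      using xy by (simp_all add: distrib_left)
    then show ?thesis using \<open>x \<noteq> 0\<close> by (simp add: vec_eq_iff forall_2 eq_neg_iff_add_eq_0)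
  qed
qed

lemma pstar_signs: "pstar {u, - u} {v, - v} = {vstar u v, - vstar u v}"
proof -
  have "pstar {u, - u} {v, - v} = {vstar u v, vstar u (- v), vstar (- u) v, vstar (- u) (- v)}"
    unfolding pstar_def by blast
  then show ?thesis by (auto simp: vstar_minus)
qed

text \<open>Two routes lead from \<open>s1\<close> to \<open>s4\<close> across a crossing.
  Self-distributivity makes \<open>vstar u v\<close> the last step of the route through
  \<open>s3\<close>, and cancellation identifies it with \<open>u'\<close> up to sign.\<close>

lemma pstar_of_quadrilateral:
  assumes "s2 = vstar s1 u" "s3 = vstar s1 v" "s4 = vstar s2 v" "s4 = vstar s3 u'" "s4 \<noteq> s3"
  shows "pstar {u, - u} {v, - v} = {u', - u'}"
proof -
  have "vstar s3 u' = vstar s3 (vstar u v)" using assms vstar_vstar by metis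
  then have "vstar u v = u' \<or> vstar u v = - u'" using vstar_cancel assms by metis
  then show ?thesis by (auto simp: pstar_signs)
qed

text \<open>The parabolic fixing \<open>z\<close>, with \<open>q\<close> the inverse square of the second entry.\<close>

definition edge_vector :: "complex \<Rightarrow> complex \<Rightarrow> vec2" where
  "edge_vector z q = vector [z / csqrt q, 1 / csqrt q]"

text \<open>For \<open>z = x - m / l\<close> the color on the right has determinant \<open>m\<close>
  with \<open>(z, 1)\<close>, so \<open>m / q\<close> times \<open>(z, 1)\<close> is added to it.
  The choice of \<open>q\<close> moves the second entry from \<open>r\<close> to
  \<open>l\<close>.\<close>

lemma vstar_edge_vector:
  assumes "l \<noteq> 0" "r \<noteq> 0" "l \<noteq> r" "m \<noteq> 0" and xy: "x - y = m * (1 / l - 1 / r)"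
  shows "vstar (vector [y * r, r]) (edge_vector (x - m / l) (m / (l - r))) = vector [x * l, l]"
proof -
  define q where "q = m / (l - r)"
  define c where "c = csqrt q"
  have q: "q \<noteq> 0" using assms by (simp add: q_def)
  have c: "c * c = q" "c \<noteq> 0" using q power2_csqrt[of q] by (auto simp: c_def power2_eq_square)
  have y: "y = x - m * (1 / l - 1 / r)" using xy by (simp add: algebra_simps)
  have det: "y * r * (1 / c) - r * ((x - m / l) / c) = m / c"
    unfolding y using assms(1,2) c(2) by (simp add: field_simps)
  have "m / c * (1 / c) = m / q" by (simp add: c(1))
  also have "m / q = l - r" using assms(3,4) by (simp add: q_def)
  finally have "m / c * (1 / c) = l - r" .
  moreover have "m / c * ((x - m / l) / c) = (m / c * (1 / c)) * (x - m / l)" by simp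
  moreover have "y * r + (l - r) * (x - m / l) = x * l"
    unfolding y using assms(1,2) by (simp add: field_simps)
  ultimately show ?thesis
    using det
    unfolding edge_vector_def q_def[symmetric] c_def[symmetric]
    by (simp add: vstar_eq vec_eq_iff forall_2 vector_2)
qed

lemma edge_vector_nonzero: "q \<noteq> 0 \<Longrightarrow> edge_vector z q \<noteq> 0"
  by (simp add: edge_vector_def vec_eq_iff forall_2 vector_2)

lemma arc_function:
  assumes "\<And>e e'. arc_joined D e e' \<Longrightarrow> f e = f e'"
  obtains a where "\<And>e. a (arc_of D e) = f e"
proof
  fix e
  have same: "f e = f e'" if "equivclp (arc_joined D) e e'" for e'
    using that by (induction rule: equivclp_induct) (use assms in metis)+
  have "e \<in> arc_of D e" by (simp add: arc_of_def)
  then have "(SOME e'. e' \<in> arc_of D e) \<in> arc_of D e" by (rule someI)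
  then show "f (SOME e'. e' \<in> arc_of D e) = f e" using same by (simp add: arc_of_def)
qed

section \<open>The colorings belonging to a solution\<close>

theorem theoremA1:
  fixes D :: "('c::finite, 'r::finite) diagram" and w :: "'r \<Rightarrow> complex"
  assumes "link_diagram D"
    and "no_bare_component D"
    and "hyperbolicity_solution D w"
    and "essential D w"
  shows "\<exists>a s p. arc_coloring D a \<and> region_coloring D a s \<and> p \<noteq> 0 \<and>
           (\<forall>k. w k = det2 p (s k))"
proof -
  note D = assms(1) and sol = assms(1,3,4)
  let ?l = "\<lambda>e. left_region D e" and ?r = "\<lambda>e. right_region D e"
  have ne: "w k \<noteq> 0" "w (?l e) \<noteq> w (?r e)" for k e
    using assms(4) unfolding essential_def by blast+
  note regions = edge_regions[OF D]
  have "factor_at D w q \<noteq> 0" for q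
    using solution_ratio_nonzero[OF sol] by (simp add: factor_at_def)
  from integrate_ratios[OF D this solution_crossing[OF sol] solution_region[OF sol]]
  obtain m where m0: "\<And>e. m e \<noteq> 0"
    and m: "\<And>q. m (edge_after D q) = factor_at D w q * m (edge_before D q)" by blast
  \<comment> \<open>In order: closedness at the crossing, equal scale on both halves of the
    over-strand, and equal fixed points. The last is stated through the under-edge on the left of
    the over-strand, because \<open>x\<close> is constructed only afterwards.\<close>
  have crossing: "m (j, Over) * (1 / w (?l (j, Over)) - 1 / w (?r (j, Over))) +
        m (j, Under) * (1 / w (?l (j, Under)) - 1 / w (?r (j, Under))) =
        m (pred D (j, Over)) * (1 / w (?l (pred D (j, Over))) - 1 / w (?r (pred D (j, Over)))) +
        m (pred D (j, Under)) * (1 / w (?l (pred D (j, Under))) - 1 / w (?r (pred D (j, Under)))) \<and>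
      m (j, Over) / (w (?l (j, Over)) - w (?r (j, Over))) =
        m (pred D (j, Over)) / (w (?l (pred D (j, Over))) - w (?r (pred D (j, Over)))) \<and>
      (if positive D j then
        m (j, Under) * (1 / w (?l (j, Under)) - 1 / w (?r (j, Under))) =
        m (pred D (j, Over)) / w (?l (pred D (j, Over))) - m (j, Over) / w (?l (j, Over))
       else
        m (pred D (j, Under)) * (1 / w (?l (pred D (j, Under))) - 1 / w (?r (pred D (j, Under)))) =
        m (j, Over) / w (?l (j, Over)) - m (pred D (j, Over)) / w (?l (pred D (j, Over))))" for j
  proof -
    define a b c d where abcd: "a = w (region D (j, North))" "b = w (region D (j, West))"
      "c = w (region D (j, South))" "d = w (region D (j, East))"
    have abcd_ne: "a \<noteq> 0" "b \<noteq> 0" "c \<noteq> 0" "d \<noteq> 0" "a \<noteq> b" "b \<noteq> c" "c \<noteq> d" "a \<noteq> d"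
      "b * d - a * c \<noteq> 0"
      using essential_corners[OF D assms(4), of j] solution_branch_free[OF sol, of j]
      unfolding abcd by blast+
    show ?thesis
    proof (cases "positive D j")
      case True
      then have "m (j, Under) = (b * d - a * c) / ((b - c) * (a - b)) * m (pred D (j, Over))"
        "m (j, Over) = (a - b) * (a - d) / (b * d - a * c) * m (j, Under)"
        "m (pred D (j, Under)) = (b * d - a * c) / ((d - c) * (a - d)) * m (j, Over)"
        using m[of "(j, West)"] m[of "(j, North)"] m[of "(j, East)"]
        by (simp_all add: factor_at_def rise_def fall_def abcd)
      from positive_crossing[OF abcd_ne this] show ?thesis
        by (simp add: True regions flip: abcd)
    next
      case False
      then have "m (j, Over) = (b - c) * (a - b) / (b * d - a * c) * m (pred D (j, Under))"
        "m (j, Under) = (b * d - a * c) / ((a - b) * (a - d)) * m (j, Over)"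
        "m (pred D (j, Over)) = (d - c) * (a - d) / (b * d - a * c) * m (j, Under)"
        using m[of "(j, West)"] m[of "(j, North)"] m[of "(j, East)"]
        by (simp_all add: factor_at_def rise_def fall_def abcd)
      from negative_crossing[OF abcd_ne this] show ?thesis
        by (simp add: False regions add.commute flip: abcd)
    qed
  qed
  have "\<exists>x. \<forall>e. m e * (1 / w (?l e) - 1 / w (?r e)) = x (?l e) - x (?r e)"
    using crossing by (intro integrate_over_regions[OF D]) blast
  then obtain x where x: "\<And>e. x (?l e) - x (?r e) = m e * (1 / w (?l e) - 1 / w (?r e))"
    by metis
  define s :: "'r \<Rightarrow> vec2" where "s k = vector [x k * w k, w k]" for k
  define u where "u e = edge_vector (x (?l e) - m e / w (?l e)) (m e / (w (?l e) - w (?r e)))" for e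
  have u: "s (?l e) = vstar (s (?r e)) (u e)" for e
    unfolding s_def u_def using vstar_edge_vector[OF ne(1) ne(1) ne(2) m0 x] by simp
  have u0: "u e \<noteq> 0" for e
    unfolding u_def using m0 ne(2) by (intro edge_vector_nonzero) simp
  have over: "u (j, Over) = u (pred D (j, Over))" for j
  proof -
    have "x (?l (j, Over)) - m (j, Over) / w (?l (j, Over)) =
      x (?l (pred D (j, Over))) - m (pred D (j, Over)) / w (?l (pred D (j, Over)))"
    proof (cases "positive D j")
      case True
      then have "?l (j, Under) = ?l (pred D (j, Over))" "?r (j, Under) = ?l (j, Over)"
        by (simp_all add: regions)
      with x[of "(j, Under)"] crossing[of j] True
      have "x (?l (pred D (j, Over))) - x (?l (j, Over)) =
          m (pred D (j, Over)) / w (?l (pred D (j, Over))) - m (j, Over) / w (?l (j, Over))"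
        by metis
      then show ?thesis by (simp add: algebra_simps)
    next
      case False
      then have "?r (pred D (j, Under)) = ?l (pred D (j, Over))" "?l (pred D (j, Under)) = ?l (j, Over)"
        by (simp_all add: regions)
      with x[of "pred D (j, Under)"] crossing[of j] False
      have "x (?l (j, Over)) - x (?l (pred D (j, Over))) =
          m (j, Over) / w (?l (j, Over)) - m (pred D (j, Over)) / w (?l (pred D (j, Over)))"
        by metis
      then show ?thesis by (simp add: algebra_simps)
    qed
    then show ?thesis using crossing[of j] by (simp add: u_def)
  qed
  have "{u e, - u e} = {u e', - u e'}" if "arc_joined D e e'" for e e'
  proof -
    have "e = pred D e'" "snd e' = Over" using that succ_pred(2)[OF D] unfolding arc_joined_def by metis+
    then show ?thesis using over[of "fst e'"] by (cases e') simp
  qed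
  from arc_function[of D "\<lambda>e. {u e, - u e}", OF this]
  obtain a where a: "\<And>e. a (arc_of D e) = {u e, - u e}" by blast
  have s_ne: "s k \<noteq> s k'" if "w k \<noteq> w k'" for k k'
    using that by (simp add: s_def vec_eq_iff forall_2 vector_2)
  have "arc_coloring D a"
    unfolding arc_coloring_def
  proof (intro conjI allI impI)
    show "a (arc_of D e) \<in> parabolics" for e
      using a u0 unfolding parabolics_def by blast
    fix j e assume "succ D e = (j, Under)"
    then have e: "e = pred D (j, Under)" using succ_pred[OF D] by metis
    \<comment> \<open>East is to the right of both strands and West to the left of both; the two
      routes from East to West form the quadrilateral. The second entry of \<open>s\<close> is
      \<open>w\<close>, so the colors beside an under-edge differ and cancellation applies.\<close>
    have "if positive D j then pstar {u e, - u e} {u (j, Over), - u (j, Over)} = {u (j, Under), - u (j, Under)}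
      else pstar {u (j, Under), - u (j, Under)} {u (j, Over), - u (j, Over)} = {u e, - u e}"
    proof (cases "positive D j")
      case True
      have "pstar {u e, - u e} {u (j, Over), - u (j, Over)} = {u (j, Under), - u (j, Under)}"
        by (rule pstar_of_quadrilateral[of "s (region D (j, South))" "s (region D (j, East))" _
              "s (region D (j, North))" _ "s (region D (j, West))"])
           (use u[of e] u[of "(j, Over)"] u[of "(j, Under)"] u[of "pred D (j, Over)"]
             s_ne[OF ne(2)[of "(j, Under)"]] True in \<open>simp_all add: e regions over\<close>)
      then show ?thesis using True by simp
    next
      case False
      have "pstar {u (j, Under), - u (j, Under)} {u (j, Over), - u (j, Over)} = {u e, - u e}"
        by (rule pstar_of_quadrilateral[of "s (region D (j, North))" "s (region D (j, East))" _
              "s (region D (j, South))" _ "s (region D (j, West))"])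
           (use u[of e] u[of "(j, Over)"] u[of "(j, Under)"] u[of "pred D (j, Over)"]
             s_ne[OF ne(2)[of e]] False in \<open>simp_all add: e regions over\<close>)
      then show ?thesis using False by simp
    qed
    then show "let over = a (arc_of D (j, Over)); under_in = a (arc_of D e); under_out = a (arc_of D (j, Under))
      in if positive D j then under_out = pstar under_in over else under_in = pstar under_out over"
      by (auto simp: a Let_def)
  qed
  moreover have "region_coloring D a s"
    unfolding region_coloring_def
  proof (intro conjI allI ballI)
    show "s k \<noteq> 0" for k
      using ne(1)[of k] by (simp add: s_def vec_eq_iff forall_2 vector_2)
    show "s (?l e) = vstar (s (?r e)) v" if "v \<in> a (arc_of D e)" for e v
      using that u[of e] by (auto simp: a vstar_minus)
  qed
  moreover have "vector [1, 0] \<noteq> (0 :: vec2)"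
    by (simp add: vec_eq_iff forall_2 vector_2)
  moreover have "w k = det2 (vector [1, 0]) (s k)" for k
    by (simp add: det2_eq s_def vector_2)
  ultimately show ?thesis by blast
qed

end
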